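(* Let $\mathbb{F}\in\{\mathbb{R},\mathbb{C}\}$, $n\in\mathbb{N}$, $r,m\in\mathbb{Z}_+$, let $\mathcal{A}\in\mathbb{F}^{n\times n}/{\sim}$ and $\mathcal{C}\in\mathbb{F}^{m\times n}/{\sim}$ be nonzero patterns, and let $t_0,t_1\in\mathbb{R}$ with $t_0<t_1$. Then the following four statements are equivalent. (i) Every continuous-time system $\dot x(t)=A(t)x(t)+B(t)u(t)$, $y(t)=C(t)x(t)+D(t)u(t)$ of output pattern $(\mathcal{A},\mathcal{C})$ is observable on $[t_0,t_1]$. (ii) Every exponentially scaled continuous-time system $\dot x(t)=A(t)x(t)+B(t)u(t)$, $y(t)=C(t)x(t)+D(t)u(t)$ of output pattern $(\mathcal{A},\mathcal{C})$ is observable on $[t_0,t_1]$. (iii) Every time-invariant continuous-time system $\dot x(t)=A(t)x(t)+B(t)u(t)$, $y(t)=C(t)x(t)+D(t)u(t)$ of output pattern $([\mathrm{id}]_{\sim}+\mathcal{A},\mathcal{C})$ is observable. (iv) For every non-empty subset $V\subseteq\{1,\dots,n\}$ of vertices of the graph $\mathcal{G}(\mathcal{A}^{\ast},\mathcal{C}^{\ast})$ there exists some vertex $v\in\{1,\dots,n+m\}\setminus V$ such that $V$ contains exactly one successor of $v$ in $\mathcal{G}(\mathcal{A}^{\ast},\mathcal{C}^{\ast})$.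
   Context: $\mathbb{Z}_+$ is the set of non-negative integers and $\mathbb{N}=\mathbb{Z}_+\setminus\{0\}$. Nonzero patterns: for $X,Y\in\mathbb{F}^{p\times q}$ write $X\sim Y$ iff the positions of the zero entries of $X$ and $Y$ coincide. The equivalence classes $[X]_{\sim}\in\mathbb{F}^{p\times q}/{\sim}$ are called (nonzero) patterns; a pattern is represented by a matrix of symbols $\star$ (nonzero entry) and $\circ$ (zero entry). Operations on patterns: $[X]_{\sim}+[Y]_{\sim}=[\,|X|+|Y|\,]_{\sim}$, where $|X|$ is the matrix with entries $|X_{i,j}|$; $([X]_{\sim},[Y]_{\sim})=[(X,Y)]_{\sim}$; $[X]_{\sim}^{\ast}=[X^{\ast}]_{\sim}$, where $X^{\ast}$ is the transpose of $X$ if $\mathbb{F}=\mathbb{R}$ and the conjugate transpose if $\mathbb{F}=\mathbb{C}$. $\mathrm{id}$ is the $n\times n$ identity matrix. Graph: the directed graph $\mathcal{G}(\mathcal{A}^{\ast},\mathcal{C}^{\ast})$ has vertices $1,\dots,n+m$, and there is an edge from vertex $v$ to vertex $w$ iff $1\le w\le n$ and $(\mathcal{A}^{\ast},\mathcal{C}^{\ast})_{w,v}=\star$. In that case $w$ is called a successor of $v$. Systems: a continuous-time system $\dot x(t)=A(t)x(t)+B(t)u(t)$, $y(t)=C(t)x(t)+D(t)u(t)$ over $\mathbb{F}$ is given by coefficients $A(t)\in\mathbb{F}^{n\times n}$, $B(t)\in\mathbb{F}^{n\times r}$, $C(t)\in\mathbb{F}^{m\times n}$, $D(t)\in\mathbb{F}^{m\times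 r}$ defined for all $t\in\mathbb{R}$, where $A$ and $B$ are always assumed locally integrable. Input signals $u$ with values in $\mathbb{F}^r$ are assumed measurable and locally essentially bounded. A solution is an absolutely continuous function $x$ satisfying the differential equation for almost every $t$; $\varphi(\cdot,t_0,x_0,u)$ denotes the unique solution on $[t_0,\infty)$ with $\varphi(t_0,t_0,x_0,u)=x_0$, and its value at $t$ depends only on $u$ restricted to $[t_0,t)$. The system is time-invariant if all coefficient matrices are constant. It is of output pattern $(\mathcal{A},\mathcal{C})$ if $A$ and $C$ are locally integrable and $A(t)\in\mathcal{A}$, $C(t)\in\mathcal{C}$ for almost every $t\in\mathbb{R}$. It is exponentially scaled if there exist a diagonal matrix $\Lambda\in\mathbb{F}^{n\times n}$ and matrices $A_0\in\mathbb{F}^{n\times n}$, $B_0\in\mathbb{F}^{n\times r}$, $C_0\in\mathbb{F}^{m\times n}$ such that $A(t)=e^{-\Lambda t}A_0e^{\Lambda t}-\Lambda$, $B(t)=e^{-\Lambda t}B_0$ and $C(t)=C_0e^{\Lambda t}$ for every $t\in\mathbb{R}$. Observability: for real $\tau_0\le\tau_1$, the events $(\tau_0,x_0)$ and $(\tau_0,x_1)$ are indistinguishable on $[\tau_0,\tau_1]$ if $x_0,x_1\in\mathbb{F}^n$ and for every input $u\colon[\tau_0,\tau_1)\to\mathbb{F}^r$ and almost every $t\in[\tau_0,\tau_1]$ we have $C(t)\varphi(t,\tau_0,x_0,u)=C(t)\varphi(t,\tau_0,x_1,u)$. The system is observable on $[t_0,t_1]$ if $x_0=x_1$ whenever $(t_0,x_0)$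 and $(t_0,x_1)$ are indistinguishable on $[t_0,t_1]$. It is observable if indistinguishability of $(\tau_0,x_0)$ and $(\tau_0,x_1)$ on $[\tau_0,\tau_1]$ for all $\tau_0$ and all $\tau_1\ge\tau_0$ implies $x_0=x_1$. *)

theory Defs
  imports
    "HOL-Analysis.Analysis"
    "Jordan_Normal_Form.Schur_Decomposition"
    "Graph_Theory.Pair_Digraph"
begin

text \<open>Matrices are those of \<open>Jordan_Normal_Form\<close>, so that the dimensions \<open>r\<close> and \<open>m\<close> may be zero.
  A pattern is an equivalence class of matrices of a fixed format.\<close>

definition same_pattern :: "nat \<Rightarrow> nat \<Rightarrow> 'a::zero mat rel" where
  "same_pattern p q = {(X, Y). X \<in> carrier_mat p q \<and> Y \<in> carrier_mat p q \<and>
     (\<forall>i<p. \<forall>j<q. X $$ (i, j) = 0 \<longleftrightarrow> Y $$ (i, j) = 0)}"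

definition patterns :: "nat \<Rightarrow> nat \<Rightarrow> 'a::zero mat set set" where
  "patterns p q = carrier_mat p q // same_pattern p q"

definition pattern_of :: "'a::zero mat \<Rightarrow> 'a mat set" where
  "pattern_of X = same_pattern (dim_row X) (dim_col X) `` {X}"

definition abs_mat :: "'a::real_normed_field mat \<Rightarrow> 'a mat" where
  "abs_mat X = map_mat (\<lambda>x. of_real (norm x)) X"

definition append_cols :: "'a mat \<Rightarrow> 'a mat \<Rightarrow> 'a mat" where
  "append_cols X Y = mat (dim_row X) (dim_col X + dim_col Y)
     (\<lambda>(i, j). if j < dim_col X then X $$ (i, j) else Y $$ (i, j - dim_col X))"

text \<open>The operations on patterns do not depend on the representatives, so each union below is a
  union of copies of one and the same class.\<close>

definition pattern_add :: "'a::real_normed_field mat set \<Rightarrow> 'a mat set \<Rightarrow> 'a mat set" where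
  "pattern_add P Q = (\<Union>X\<in>P. \<Union>Y\<in>Q. pattern_of (abs_mat X + abs_mat Y))"

definition pattern_append :: "'a::zero mat set \<Rightarrow> 'a mat set \<Rightarrow> 'a mat set" where
  "pattern_append P Q = (\<Union>X\<in>P. \<Union>Y\<in>Q. pattern_of (append_cols X Y))"

definition pattern_adjoint :: "'a::conjugatable_field mat set \<Rightarrow> 'a mat set" where
  "pattern_adjoint P = (\<Union>X\<in>P. pattern_of (mat_adjoint X))"

definition pattern_star :: "'a::zero mat set \<Rightarrow> nat \<Rightarrow> nat \<Rightarrow> bool" where
  "pattern_star P i j \<longleftrightarrow> (\<exists>X\<in>P. X $$ (i, j) \<noteq> 0)"

text \<open>Vertices are numbered from 1, matrix indices from 0.\<close>

definition pattern_graph ::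
  "nat \<Rightarrow> nat \<Rightarrow> 'a::conjugatable_field mat set \<Rightarrow> 'a mat set \<Rightarrow> nat pair_pre_digraph" where
  "pattern_graph n m \<A> \<C> =
     \<lparr> pverts = {1..n + m},
       parcs = {(v, w). v \<in> {1..n + m} \<and> w \<in> {1..n} \<and>
         pattern_star (pattern_append (pattern_adjoint \<A>) (pattern_adjoint \<C>)) (w - 1) (v - 1)} \<rparr>"

text \<open>The scalar type is meant to be instantiated to \<open>real\<close> or \<open>complex\<close>.\<close>

record 'a ct_system =
  coeff_A :: "real \<Rightarrow> 'a mat"
  coeff_B :: "real \<Rightarrow> 'a mat"
  coeff_C :: "real \<Rightarrow> 'a mat"
  coeff_D :: "real \<Rightarrow> 'a mat"

definition locally_integrable_mat ::
  "nat \<Rightarrow> nat \<Rightarrow> (real \<Rightarrow> 'a::{real_normed_field, euclidean_space} mat) \<Rightarrow> bool" where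
  "locally_integrable_mat p q M \<longleftrightarrow>
     (\<forall>i<p. \<forall>j<q. \<forall>a b. (\<lambda>t. M t $$ (i, j)) absolutely_integrable_on {a..b})"

definition is_ct_system ::
  "nat \<Rightarrow> nat \<Rightarrow> nat \<Rightarrow> 'a::{real_normed_field, euclidean_space} ct_system \<Rightarrow> bool" where
  "is_ct_system n r m S \<longleftrightarrow>
     (\<forall>t. coeff_A S t \<in> carrier_mat n n \<and> coeff_B S t \<in> carrier_mat n r \<and>
          coeff_C S t \<in> carrier_mat m n \<and> coeff_D S t \<in> carrier_mat m r) \<and>
     locally_integrable_mat n n (coeff_A S) \<and> locally_integrable_mat n r (coeff_B S)"

definition of_output_pattern ::
  "nat \<Rightarrow> nat \<Rightarrow> 'a::{real_normed_field, euclidean_space} mat set \<Rightarrow> 'a mat set \<Rightarrow> 'a ct_system \<Rightarrow> bool" where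
  "of_output_pattern n m \<A> \<C> S \<longleftrightarrow>
     locally_integrable_mat n n (coeff_A S) \<and> locally_integrable_mat m n (coeff_C S) \<and>
     (AE t in lebesgue. coeff_A S t \<in> \<A> \<and> coeff_C S t \<in> \<C>)"

definition time_invariant :: "'a ct_system \<Rightarrow> bool" where
  "time_invariant S \<longleftrightarrow>
     (\<exists>A0 B0 C0 D0. \<forall>t. coeff_A S t = A0 \<and> coeff_B S t = B0 \<and> coeff_C S t = C0 \<and> coeff_D S t = D0)"

definition mat_exp :: "'a::real_normed_field mat \<Rightarrow> 'a mat" where
  "mat_exp X = mat (dim_row X) (dim_col X) (\<lambda>(i, j). \<Sum>k. (X ^\<^sub>m k) $$ (i, j) / fact k)"

definition exponentially_scaled ::
  "nat \<Rightarrow> nat \<Rightarrow> nat \<Rightarrow> 'a::real_normed_field ct_system \<Rightarrow> bool" where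
  "exponentially_scaled n r m S \<longleftrightarrow>
     (\<exists>\<Lambda> \<in> carrier_mat n n. \<exists>A0 \<in> carrier_mat n n. \<exists>B0 \<in> carrier_mat n r. \<exists>C0 \<in> carrier_mat m n.
        diagonal_mat \<Lambda> \<and>
        (\<forall>t. coeff_A S t =
               mat_exp (of_real (- t) \<cdot>\<^sub>m \<Lambda>) * A0 * mat_exp (of_real t \<cdot>\<^sub>m \<Lambda>) - \<Lambda> \<and>
             coeff_B S t = mat_exp (of_real (- t) \<cdot>\<^sub>m \<Lambda>) * B0 \<and>
             coeff_C S t = C0 * mat_exp (of_real t \<cdot>\<^sub>m \<Lambda>)))"

text \<open>Inputs on the half-open interval need not be bounded near its right end point: local
  essential boundedness refers to the compact subsets of the domain.\<close>

definition input_signal ::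
  "nat \<Rightarrow> real \<Rightarrow> real \<Rightarrow> (real \<Rightarrow> 'a::real_normed_field vec) \<Rightarrow> bool" where
  "input_signal r \<tau>0 \<tau>1 u \<longleftrightarrow>
     (\<forall>t\<in>{\<tau>0..<\<tau>1}. u t \<in> carrier_vec r) \<and>
     (\<forall>i<r. (\<lambda>t. vec_index (u t) i) \<in> borel_measurable (lebesgue_on {\<tau>0..<\<tau>1})) \<and>
     (\<forall>i<r. \<forall>K. compact K \<and> K \<subseteq> {\<tau>0..<\<tau>1} \<longrightarrow>
        (\<exists>b. AE t in lebesgue. t \<in> K \<longrightarrow> norm (vec_index (u t) i) \<le> b))"

definition abs_continuous :: "real \<Rightarrow> real \<Rightarrow> (real \<Rightarrow> 'b::real_normed_vector) \<Rightarrow> bool" where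
  "abs_continuous a b f \<longleftrightarrow>
     (\<forall>\<epsilon>>0. \<exists>\<delta>>0. \<forall>(k::nat) c d.
        (\<forall>i<k. a \<le> c i \<and> c i \<le> d i \<and> d i \<le> b) \<and>
        (\<forall>i<k. \<forall>j<k. i \<noteq> j \<longrightarrow> {c i<..<d i} \<inter> {c j<..<d j} = {}) \<and>
        (\<Sum>i<k. d i - c i) < \<delta>
        \<longrightarrow> (\<Sum>i<k. norm (f (d i) - f (c i))) < \<epsilon>)"

definition is_solution ::
  "nat \<Rightarrow> 'a::real_normed_field ct_system \<Rightarrow> (real \<Rightarrow> 'a vec) \<Rightarrow> real \<Rightarrow> real \<Rightarrow> (real \<Rightarrow> 'a vec) \<Rightarrow> bool" where
  "is_solution n S u a b x \<longleftrightarrow>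
     (\<forall>t\<in>{a..b}. x t \<in> carrier_vec n) \<and>
     (\<forall>i<n. abs_continuous a b (\<lambda>t. vec_index (x t) i)) \<and>
     (AE t in lebesgue. t \<in> {a..b} \<longrightarrow>
        (\<forall>i<n. ((\<lambda>s. vec_index (x s) i) has_vector_derivative
           vec_index (coeff_A S t *\<^sub>v x t + coeff_B S t *\<^sub>v u t) i) (at t)))"

text \<open>The value at \<open>t\<close> of the unique solution of the initial value problem. It is read off from the
  solution on \<open>[t\<^sub>0, t]\<close>, so that \<open>u\<close> only has to be defined on \<open>[t\<^sub>0, t)\<close>.\<close>

definition phi ::
  "nat \<Rightarrow> 'a::real_normed_field ct_system \<Rightarrow> real \<Rightarrow> real \<Rightarrow> 'a vec \<Rightarrow> (real \<Rightarrow> 'a vec) \<Rightarrow> 'a vec" where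
  "phi n S t t0 x0 u = (THE z. \<exists>x. is_solution n S u t0 t x \<and> x t0 = x0 \<and> x t = z)"

definition indistinguishable ::
  "nat \<Rightarrow> nat \<Rightarrow> 'a::real_normed_field ct_system \<Rightarrow> real \<Rightarrow> real \<Rightarrow> 'a vec \<Rightarrow> 'a vec \<Rightarrow> bool" where
  "indistinguishable n r S \<tau>0 \<tau>1 x0 x1 \<longleftrightarrow>
     x0 \<in> carrier_vec n \<and> x1 \<in> carrier_vec n \<and>
     (\<forall>u. input_signal r \<tau>0 \<tau>1 u \<longrightarrow>
        (AE t in lebesgue. t \<in> {\<tau>0..\<tau>1} \<longrightarrow>
           coeff_C S t *\<^sub>v phi n S t \<tau>0 x0 u = coeff_C S t *\<^sub>v phi n S t \<tau>0 x1 u))"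

definition observable_on ::
  "nat \<Rightarrow> nat \<Rightarrow> 'a::real_normed_field ct_system \<Rightarrow> real \<Rightarrow> real \<Rightarrow> bool" where
  "observable_on n r S t0 t1 \<longleftrightarrow>
     (\<forall>x0 x1. indistinguishable n r S t0 t1 x0 x1 \<longrightarrow> x0 = x1)"

definition observable :: "nat \<Rightarrow> nat \<Rightarrow> 'a::real_normed_field ct_system \<Rightarrow> bool" where
  "observable n r S \<longleftrightarrow>
     (\<forall>x0 x1. (\<forall>\<tau>0 \<tau>1. \<tau>0 \<le> \<tau>1 \<longrightarrow> indistinguishable n r S \<tau>0 \<tau>1 x0 x1) \<longrightarrow> x0 = x1)"

definition all_systems_observable ::
  "nat \<Rightarrow> nat \<Rightarrow> nat \<Rightarrow> real \<Rightarrow> real \<Rightarrow> 'a::{real_normed_field, euclidean_space} mat set \<Rightarrow> 'a mat set \<Rightarrow> bool" where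
  "all_systems_observable n r m t0 t1 \<A> \<C> \<longleftrightarrow>
     (\<forall>S. is_ct_system n r m S \<and> of_output_pattern n m \<A> \<C> S \<longrightarrow> observable_on n r S t0 t1)"

definition all_exp_scaled_systems_observable ::
  "nat \<Rightarrow> nat \<Rightarrow> nat \<Rightarrow> real \<Rightarrow> real \<Rightarrow> 'a::{real_normed_field, euclidean_space} mat set \<Rightarrow> 'a mat set \<Rightarrow> bool" where
  "all_exp_scaled_systems_observable n r m t0 t1 \<A> \<C> \<longleftrightarrow>
     (\<forall>S. is_ct_system n r m S \<and> exponentially_scaled n r m S \<and> of_output_pattern n m \<A> \<C> S
        \<longrightarrow> observable_on n r S t0 t1)"

definition all_time_invariant_systems_observable ::
  "nat \<Rightarrow> nat \<Rightarrow> nat \<Rightarrow> 'a::{real_normed_field, euclidean_space} mat set \<Rightarrow> 'a mat set \<Rightarrow> bool" where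
  "all_time_invariant_systems_observable n r m \<A> \<C> \<longleftrightarrow>
     (\<forall>S. is_ct_system n r m S \<and> time_invariant S \<and> of_output_pattern n m \<A> \<C> S
        \<longrightarrow> observable n r S)"

definition unique_successor_condition ::
  "nat \<Rightarrow> nat pair_pre_digraph \<Rightarrow> bool" where
  "unique_successor_condition n G \<longleftrightarrow>
     (\<forall>V. V \<noteq> {} \<and> V \<subseteq> {1..n} \<longrightarrow>
        (\<exists>v \<in> pverts G - V. \<exists>!w. w \<in> V \<and> (v, w) \<in> parcs G))"

end

theory Submission
  imports Defs
begin

text \<open>
  Write \<open>z\<close> for the difference of two solutions with the same input; it satisfies
  \<open>z' = A z\<close> almost everywhere, and the two initial events are indistinguishable exactly if
  \<open>C z = 0\<close> almost everywhere. The graph condition says: for every non-empty set \<open>V\<close> of columns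
  some row of \<open>C\<close>, or some row of \<open>A\<close> whose index lies outside \<open>V\<close>, has exactly one star in the
  columns \<open>V\<close>.

  Sufficiency. Let \<open>V\<close> be the set of components of \<open>z\<close> that do not vanish identically. If \<open>V\<close> were
  non-empty, then the row given by the condition would read \<open>0 = a z\<^sub>w\<close> almost everywhere, with a
  coefficient \<open>a\<close> that is nonzero almost everywhere and a single \<open>w\<close> in \<open>V\<close>: for a row of \<open>C\<close> the left-hand
  side is the output, and for a row \<open>v\<close> of \<open>A\<close> it is the derivative of the identically vanishing
  component \<open>z\<^sub>v\<close>. By continuity \<open>z\<^sub>w\<close> vanishes, a contradiction. So \<open>z = 0\<close>
  (\<open>unobserved_trajectory_vanishes\<close>). As \<open>w\<close> differs from \<open>v\<close>, the condition speaks of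
  off-diagonal entries of \<open>A\<close> only; hence it is the same condition for the pattern with full diagonal
  in the time-invariant statement, and the same argument applies.

  Necessity. If \<open>V\<close> violates the condition, then every row of \<open>C\<close>, and every row of \<open>A\<close> outside \<open>V\<close>,
  has no star or at least two stars in the columns \<open>V\<close>, so its nonzero entries can be chosen with sum
  \<open>0\<close> over \<open>V\<close> (\<open>row_with_zero_sum\<close>). The off-diagonal entries of the rows in \<open>V\<close> are taken to be \<open>1\<close>
  or \<open>0\<close>, and their diagonal entries make the row sums over \<open>V\<close> equal to a prescribed \<open>\<mu>\<close>. Then
  the indicator vector of \<open>V\<close> is an eigenvector with eigenvalue \<open>\<mu>\<close> on which \<open>C\<close> vanishes. For a
  large \<open>\<mu>\<close> the diagonal entries are nonzero and this is an unobservable time-invariant system. For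
  \<open>\<mu> = 0\<close> the wrong diagonal is repaired by exponential scaling: the coordinate change
  \<open>e\<^sup>-\<^sup>\<Lambda>\<^sup>t\<close> keeps the off-diagonal zero pattern and subtracts \<open>\<Lambda>\<close> from the diagonal, while the
  constant unobserved solution turns into an unobserved exponential one.

  As solutions are Caratheodory solutions and their values are defined by unique description,
  sufficiency rests on existence and uniqueness for linear equations with merely integrable
  coefficients (\<open>integral_equation_exists\<close>, \<open>integral_equation_unique\<close>), and necessity, where the
  solutions are explicit, on uniqueness. This needs the two halves
  of the fundamental theorem for the Lebesgue integral: an indefinite integral is absolutely
  continuous with the integrand as its derivative almost everywhere, and an absolutely continuous
  function is the integral of its derivative (\<open>abs_continuous_eq_integral\<close>).
\<close>

section \<open>Absolutely continuous functions\<close>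

lemma abs_continuous_diff:
  assumes f: "abs_continuous a b f" and g: "abs_continuous a b g"
  shows "abs_continuous a b (\<lambda>t. f t - g t)"
  unfolding abs_continuous_def
proof (intro allI impI)
  fix e :: real assume "e > 0"
  hence "e / 2 > 0" by simp
  from f[unfolded abs_continuous_def, rule_format, OF this] obtain d1 where d1: "d1 > 0"
    and D1: "\<And>(k::nat) c d. (\<forall>i<k. a \<le> c i \<and> c i \<le> d i \<and> d i \<le> b) \<and>
        (\<forall>i<k. \<forall>j<k. i \<noteq> j \<longrightarrow> {c i<..<d i} \<inter> {c j<..<d j} = {}) \<and> (\<Sum>i<k. d i - c i) < d1
        \<Longrightarrow> (\<Sum>i<k. norm (f (d i) - f (c i))) < e / 2" by blast
  from g[unfolded abs_continuous_def, rule_format, OF \<open>e / 2 > 0\<close>] obtain d2 where d2: "d2 > 0"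
    and D2: "\<And>(k::nat) c d. (\<forall>i<k. a \<le> c i \<and> c i \<le> d i \<and> d i \<le> b) \<and>
        (\<forall>i<k. \<forall>j<k. i \<noteq> j \<longrightarrow> {c i<..<d i} \<inter> {c j<..<d j} = {}) \<and> (\<Sum>i<k. d i - c i) < d2
        \<Longrightarrow> (\<Sum>i<k. norm (g (d i) - g (c i))) < e / 2" by blast
  show "\<exists>\<delta>>0. \<forall>(k::nat) c d.
        (\<forall>i<k. a \<le> c i \<and> c i \<le> d i \<and> d i \<le> b) \<and>
        (\<forall>i<k. \<forall>j<k. i \<noteq> j \<longrightarrow> {c i<..<d i} \<inter> {c j<..<d j} = {}) \<and>
        (\<Sum>i<k. d i - c i) < \<delta>
        \<longrightarrow> (\<Sum>i<k. norm (f (d i) - g (d i) - (f (c i) - g (c i)))) < e"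
  proof (intro exI[of _ "min d1 d2"] conjI allI impI)
    fix k :: nat and c d :: "nat \<Rightarrow> real"
    assume H: "(\<forall>i<k. a \<le> c i \<and> c i \<le> d i \<and> d i \<le> b) \<and>
        (\<forall>i<k. \<forall>j<k. i \<noteq> j \<longrightarrow> {c i<..<d i} \<inter> {c j<..<d j} = {}) \<and>
        (\<Sum>i<k. d i - c i) < min d1 d2"
    have "(\<Sum>i<k. norm (f (d i) - g (d i) - (f (c i) - g (c i))))
        \<le> (\<Sum>i<k. norm (f (d i) - f (c i)) + norm (g (d i) - g (c i)))"
    proof (rule sum_mono)
      fix i
      have "f (d i) - g (d i) - (f (c i) - g (c i)) = (f (d i) - f (c i)) - (g (d i) - g (c i))"
        by simp
      thus "norm (f (d i) - g (d i) - (f (c i) - g (c i))) \<le> norm (f (d i) - f (c i)) + norm (g (d i) - g (c i))"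
        by (metis norm_triangle_ineq4)
    qed
    also have "\<dots> = (\<Sum>i<k. norm (f (d i) - f (c i))) + (\<Sum>i<k. norm (g (d i) - g (c i)))"
      by (rule sum.distrib)
    also have "\<dots> < e / 2 + e / 2"
      using D1[of k c d] D2[of k c d] H by (intro add_strict_mono) auto
    finally show "(\<Sum>i<k. norm (f (d i) - g (d i) - (f (c i) - g (c i)))) < e" by simp
  qed (use d1 d2 in auto)
qed

text \<open>Comparing increments covers compositions with Lipschitz functions, and also functions that
  differ from an absolutely continuous one by a constant.\<close>
lemma abs_continuous_compose_lipschitz:
  assumes g: "abs_continuous a b g"
    and f: "\<And>s t. \<lbrakk>a \<le> s; s \<le> t; t \<le> b\<rbrakk> \<Longrightarrow> norm (f t - f s) \<le> B * norm (g t - g s)"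
  shows "abs_continuous a b f"
  unfolding abs_continuous_def
proof (intro allI impI)
  fix e :: real assume "e > 0"
  define B' where "B' = max B 1"
  have B': "B' > 0" "B \<le> B'" by (auto simp: B'_def)
  from \<open>e > 0\<close> B' have "e / B' > 0" by simp
  from g[unfolded abs_continuous_def, rule_format, OF this] obtain d1 where d1: "d1 > 0"
    and D1: "\<And>(k::nat) c d. (\<forall>i<k. a \<le> c i \<and> c i \<le> d i \<and> d i \<le> b) \<and>
        (\<forall>i<k. \<forall>j<k. i \<noteq> j \<longrightarrow> {c i<..<d i} \<inter> {c j<..<d j} = {}) \<and> (\<Sum>i<k. d i - c i) < d1
        \<Longrightarrow> (\<Sum>i<k. norm (g (d i) - g (c i))) < e / B'" by blast
  show "\<exists>\<delta>>0. \<forall>(k::nat) c d.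
        (\<forall>i<k. a \<le> c i \<and> c i \<le> d i \<and> d i \<le> b) \<and>
        (\<forall>i<k. \<forall>j<k. i \<noteq> j \<longrightarrow> {c i<..<d i} \<inter> {c j<..<d j} = {}) \<and>
        (\<Sum>i<k. d i - c i) < \<delta>
        \<longrightarrow> (\<Sum>i<k. norm (f (d i) - f (c i))) < e"
  proof (intro exI[of _ d1] conjI allI impI)
    fix k :: nat and c d :: "nat \<Rightarrow> real"
    assume H: "(\<forall>i<k. a \<le> c i \<and> c i \<le> d i \<and> d i \<le> b) \<and>
        (\<forall>i<k. \<forall>j<k. i \<noteq> j \<longrightarrow> {c i<..<d i} \<inter> {c j<..<d j} = {}) \<and>
        (\<Sum>i<k. d i - c i) < d1"
    have "(\<Sum>i<k. norm (f (d i) - f (c i))) \<le> (\<Sum>i<k. B' * norm (g (d i) - g (c i)))"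
    proof (rule sum_mono)
      fix i assume "i \<in> {..<k}"
      hence "norm (f (d i) - f (c i)) \<le> B * norm (g (d i) - g (c i))"
        using H by (intro f) auto
      also have "\<dots> \<le> B' * norm (g (d i) - g (c i))"
        using B' by (intro mult_right_mono) auto
      finally show "norm (f (d i) - f (c i)) \<le> B' * norm (g (d i) - g (c i))" .
    qed
    also have "\<dots> = B' * (\<Sum>i<k. norm (g (d i) - g (c i)))" by (simp add: sum_distrib_left)
    also have "\<dots> < B' * (e / B')" using D1[OF H] B' by (intro mult_strict_left_mono)
    finally show "(\<Sum>i<k. norm (f (d i) - f (c i))) < e" using B' by simp
  qed (use d1 in auto)
qed

lemma abs_continuous_imp_continuous_on:
  assumes "abs_continuous a b f"
  shows "continuous_on {a..b} f"
  unfolding continuous_on_iff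
proof (intro ballI allI impI)
  fix x e :: real assume x: "x \<in> {a..b}" and "e > 0"
  with assms obtain D where D: "D > 0" and DD: "\<And>(k::nat) c d. (\<forall>i<k. a \<le> c i \<and> c i \<le> d i \<and> d i \<le> b) \<and>
        (\<forall>i<k. \<forall>j<k. i \<noteq> j \<longrightarrow> {c i<..<d i} \<inter> {c j<..<d j} = {}) \<and> (\<Sum>i<k. d i - c i) < D
        \<Longrightarrow> (\<Sum>i<k. norm (f (d i) - f (c i))) < e"
    unfolding abs_continuous_def by blast
  have close: "norm (f v - f u) < e" if "a \<le> u" "u \<le> v" "v \<le> b" "v - u < D" for u v
    using DD[of 1 "\<lambda>_. u" "\<lambda>_. v"] that by simp
  show "\<exists>d>0. \<forall>x'\<in>{a..b}. dist x' x < d \<longrightarrow> dist (f x') (f x) < e"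
  proof (intro exI[of _ D] conjI ballI impI)
    fix y assume "y \<in> {a..b}" "dist y x < D"
    thus "dist (f y) (f x) < e"
      using close[of x y] close[of y x] x
      by (cases "x \<le> y") (auto simp: dist_norm norm_minus_commute)
  qed (rule D)
qed

lemma abs_continuous_subinterval:
  assumes "abs_continuous a b f" "a \<le> a'" "b' \<le> b"
  shows "abs_continuous a' b' f"
  unfolding abs_continuous_def
proof (intro allI impI)
  fix e :: real assume "e > 0"
  with assms(1) obtain D where D: "D > 0" and DD: "\<And>(k::nat) c d. (\<forall>i<k. a \<le> c i \<and> c i \<le> d i \<and> d i \<le> b) \<and>
        (\<forall>i<k. \<forall>j<k. i \<noteq> j \<longrightarrow> {c i<..<d i} \<inter> {c j<..<d j} = {}) \<and> (\<Sum>i<k. d i - c i) < D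
        \<Longrightarrow> (\<Sum>i<k. norm (f (d i) - f (c i))) < e"
    unfolding abs_continuous_def by blast
  show "\<exists>\<delta>>0. \<forall>(k::nat) c d.
        (\<forall>i<k. a' \<le> c i \<and> c i \<le> d i \<and> d i \<le> b') \<and>
        (\<forall>i<k. \<forall>j<k. i \<noteq> j \<longrightarrow> {c i<..<d i} \<inter> {c j<..<d j} = {}) \<and>
        (\<Sum>i<k. d i - c i) < \<delta>
        \<longrightarrow> (\<Sum>i<k. norm (f (d i) - f (c i))) < e"
    by (intro exI[of _ D] conjI allI impI D DD) (use assms(2,3) in force)+
qed

text \<open>Choose a gauge that is so fine that the increment of \<open>f\<close> over an interval tagged by a point with
  zero derivative is at most \<open>\<epsilon>\<close> times its length, while the intervals tagged in the exceptional null
  set have small total length. Over a fine division, the former increments add up to at most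
  \<open>\<epsilon> (t - a)\<close>, and the latter are small by absolute continuity.\<close>
lemma abs_continuous_deriv_zero_imp_const:
  fixes f :: "real \<Rightarrow> 'b::real_normed_vector"
  assumes ac: "abs_continuous a b f"
    and der: "AE t in lebesgue. t \<in> {a..b} \<longrightarrow> (f has_vector_derivative 0) (at t)"
    and t: "t \<in> {a..b}"
  shows "f t = f a"
proof -
  obtain N where N: "\<And>x. x \<in> space lebesgue - N \<Longrightarrow> x \<in> {a..b} \<longrightarrow> (f has_vector_derivative 0) (at x)"
    and "N \<in> null_sets lebesgue" using AE_E3[OF der] by blast
  hence negl: "negligible N" by (simp add: negligible_iff_null_sets)
  have small: "norm (f t - f a) \<le> e * (t - a) + e" if e: "e > 0" for e
  proof -
    obtain D where D: "D > 0" and DD: "\<And>(k::nat) c d. (\<forall>i<k. a \<le> c i \<and> c i \<le> d i \<and> d i \<le> b) \<and>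
        (\<forall>i<k. \<forall>j<k. i \<noteq> j \<longrightarrow> {c i<..<d i} \<inter> {c j<..<d j} = {}) \<and> (\<Sum>i<k. d i - c i) < D
        \<Longrightarrow> (\<Sum>i<k. norm (f (d i) - f (c i))) < e"
      using ac e unfolding abs_continuous_def by blast
    \<comment> \<open>The Riemann sums of the indicator of \<open>N\<close> are exactly the total lengths of the intervals tagged in
      \<open>N\<close>, so the gauge for its zero integral controls these lengths.\<close>
    have "(indicator N has_integral (0::real)) {a..t}"
      using negl unfolding negligible_def by (metis box_real(2))
    from this[unfolded has_integral_real, rule_format, OF D]
    obtain \<gamma>0 where g0: "gauge \<gamma>0" and G0: "\<forall>p. p tagged_division_of {a..t} \<and> \<gamma>0 fine p \<longrightarrow>
        norm ((\<Sum>(x, k)\<in>p. measure lborel k *\<^sub>R indicator N x) - (0::real)) < D"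
      by (elim exE conjE)
    have "\<exists>d>0. \<forall>y. x \<in> {a..b} - N \<longrightarrow> norm (y - x) < d \<longrightarrow> norm (f y - f x) \<le> e * norm (y - x)" for x
    proof (cases "x \<in> {a..b} - N")
      case True
      hence "(f has_vector_derivative 0) (at x)" using N by auto
      hence "\<forall>e>0. \<exists>d>0. \<forall>y. norm (y - x) < d \<longrightarrow> norm (f y - f x) \<le> e * norm (y - x)"
        by (simp add: has_vector_derivative_def has_derivative_at_alt)
      thus ?thesis using e by blast
    qed (auto intro: exI[of _ 1])
    then obtain r where r: "\<And>x. r x > 0"
      and R: "\<And>x y. x \<in> {a..b} - N \<Longrightarrow> norm (y - x) < r x \<Longrightarrow> norm (f y - f x) \<le> e * norm (y - x)"
      by metis
    have "gauge (\<lambda>x. \<gamma>0 x \<inter> ball x (r x))"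
      using g0 r by (intro gauge_Int gauge_ball_dependent) auto
    then obtain p where p: "p tagged_division_of {a..t}" and fine: "(\<lambda>x. \<gamma>0 x \<inter> ball x (r x)) fine p"
      by (rule fine_division_exists_real)
    have fine0: "\<gamma>0 fine p" and fine1: "(\<lambda>x. ball x (r x)) fine p"
      using fine by (auto simp: fine_Int)
    have fin: "finite p" using p by auto
    have seg: "\<exists>u v. K = {u..v} \<and> u \<le> x \<and> x \<le> v \<and> a \<le> u \<and> v \<le> t \<and> Inf K = u \<and> Sup K = v" if xk: "(x, K) \<in> p" for x K
    proof -
      obtain u v where K: "K = {u..v}" using tagged_division_ofD(4)[OF p xk] by auto
      moreover have "x \<in> K" "K \<subseteq> {a..t}" using tagged_division_ofD(2,3)[OF p xk] by auto
      ultimately show ?thesis by (intro exI[of _ u] exI[of _ v]) auto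
    qed
    define p1 where "p1 = {xk \<in> p. fst xk \<in> N}"
    define p2 where "p2 = {xk \<in> p. fst xk \<notin> N}"
    have split: "p = p1 \<union> p2" "p1 \<inter> p2 = {}" "finite p1" "finite p2"
      using fin by (auto simp: p1_def p2_def)
    define F where "F = (\<lambda>(x::real, K). f (Sup K) - f (Inf K))"
    have "f t - f a = sum F p"
      unfolding F_def using additive_tagged_division_1[OF _ p, of f] t by simp
    also have "\<dots> = sum F p1 + sum F p2" using split by (metis sum.union_disjoint)
    finally have "norm (f t - f a) \<le> norm (sum F p1) + norm (sum F p2)"
      by (simp add: norm_triangle_ineq)
    moreover have "norm (sum F p2) \<le> e * (t - a)"
    proof -
      have "norm (sum F p2) \<le> (\<Sum>(x,K)\<in>p2. e * (Sup K - Inf K))"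
      proof (rule sum_norm_le, clarify)
        fix x K assume "(x, K) \<in> p2"
        hence xk: "(x, K) \<in> p" "x \<notin> N" by (auto simp: p2_def)
        obtain u v where K: "K = {u..v}" "u \<le> x" "x \<le> v" "a \<le> u" "v \<le> t" "Inf K = u" "Sup K = v"
          using seg[OF xk(1)] by blast
        have "K \<subseteq> ball x (r x)" using fineD[OF fine1 xk(1)] .
        moreover have "u \<in> K" "v \<in> K" using K by auto
        ultimately have "u \<in> ball x (r x)" "v \<in> ball x (r x)" by blast+
        hence "norm (u - x) < r x" "norm (v - x) < r x" by (auto simp: dist_norm norm_minus_commute)
        moreover have "x \<in> {a..b} - N" using xk K t by auto
        ultimately have "norm (f u - f x) \<le> e * norm (u - x)" "norm (f v - f x) \<le> e * norm (v - x)"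
          using R by auto
        moreover have "norm (f v - f u) \<le> norm (f v - f x) + norm (f u - f x)"
          using norm_triangle_ineq4[of "f v - f x" "f u - f x"] by simp
        ultimately have "norm (f v - f u) \<le> e * (v - u)" using K by (auto simp: algebra_simps)
        thus "norm (F (x, K)) \<le> e * (Sup K - Inf K)" using K by (simp add: F_def)
      qed
      also have "\<dots> \<le> (\<Sum>(x,K)\<in>p. e * (Sup K - Inf K))"
      proof (rule sum_mono2[OF fin])
        fix b assume "b \<in> p - p2"
        thus "0 \<le> (case b of (x, K) \<Rightarrow> e * (Sup K - Inf K))"
          using seg e by (cases b) (fastforce)
      qed (use split in auto)
      also have "\<dots> = e * (\<Sum>(x,K)\<in>p. Sup K - Inf K)"
        by (simp add: sum_distrib_left case_prod_unfold)
      also have "\<dots> = e * (t - a)"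
        using additive_tagged_division_1[OF _ p, of "\<lambda>x. x"] t by simp
      finally show ?thesis .
    qed
    moreover have "norm (sum F p1) \<le> e"
    proof -
      obtain h where h: "bij_betw h {0..<card p1} p1"
        using ex_bij_betw_nat_finite split by blast
      hence hp: "h i \<in> p1" if "i < card p1" for i using that by (auto simp: bij_betw_def)
      define c where "c i = Inf (snd (h i))" for i
      define d where "d i = Sup (snd (h i))" for i
      have segh: "snd (h i) = {c i..d i} \<and> a \<le> c i \<and> c i \<le> d i \<and> d i \<le> b" if "i < card p1" for i
        using hp[OF that] seg[of "fst (h i)" "snd (h i)"] t by (auto simp: p1_def c_def d_def)
      have "(\<Sum>i<card p1. d i - c i) = (\<Sum>(x,K)\<in>p1. Sup K - Inf K)"
        using sum.reindex_bij_betw[OF h, of "\<lambda>(x,K). Sup K - Inf K"]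
        by (simp add: c_def d_def case_prod_unfold atLeast0LessThan)
      also have "\<dots> = (\<Sum>(x,K)\<in>p1. measure lborel K *\<^sub>R indicator N x)"
      proof (intro sum.cong refl, clarify)
        fix x K assume xK: "(x,K) \<in> p1"
        then obtain u v where "K = {u..v}" "u \<le> x" "x \<le> v" "Inf K = u" "Sup K = v"
          using seg[of x K] by (auto simp: p1_def)
        thus "Sup K - Inf K = measure lborel K *\<^sub>R indicator N x"
          using xK by (simp add: p1_def)
      qed
      also have "\<dots> \<le> (\<Sum>(x,K)\<in>p. measure lborel K *\<^sub>R indicator N x)"
        by (rule sum_mono2[OF fin]) (use split in auto)
      also have "\<dots> < D" using G0 p fine0 by auto
      finally have len: "(\<Sum>i<card p1. d i - c i) < D" .
      have "{c i<..<d i} \<inter> {c j<..<d j} = {}" if "i < card p1" "j < card p1" "i \<noteq> j" for i j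
      proof -
        have "h i \<noteq> h j" using h that by (auto simp: bij_betw_def inj_on_def)
        hence "interior (snd (h i)) \<inter> interior (snd (h j)) = {}"
          using tagged_division_ofD(5)[OF p, of "fst (h i)" "snd (h i)" "fst (h j)" "snd (h j)"] hp that
          by (auto simp: p1_def)
        thus ?thesis using segh that by simp
      qed
      hence "(\<Sum>i<card p1. norm (f (d i) - f (c i))) < e"
        using segh len by (intro DD) auto
      moreover have "(\<Sum>i<card p1. norm (f (d i) - f (c i))) = (\<Sum>xk\<in>p1. norm (F xk))"
        using sum.reindex_bij_betw[OF h, of "\<lambda>xk. norm (F xk)"]
        by (simp add: c_def d_def F_def case_prod_unfold atLeast0LessThan)
      ultimately show ?thesis using norm_sum[of F p1] by linarith
    qed
    ultimately show ?thesis by linarith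
  qed
  have "norm (f t - f a) \<le> 0"
  proof (rule field_le_epsilon)
    fix e :: real assume e: "e > 0"
    have pos: "t - a + 1 > 0" using t by auto
    have "norm (f t - f a) \<le> e / (t - a + 1) * (t - a) + e / (t - a + 1)"
      by (rule small) (use e pos in simp)
    also have "\<dots> = e / (t - a + 1) * (t - a + 1)" by (simp add: distrib_left)
    also have "\<dots> = e" using pos by simp
    finally show "norm (f t - f a) \<le> 0 + e" by simp
  qed
  thus ?thesis by simp
qed

section \<open>Indefinite integrals and the fundamental theorem for absolutely continuous functions\<close>

lemma absolutely_integrable_mult_continuous:
  fixes f g :: "real \<Rightarrow> 'a::{real_normed_field, euclidean_space}"
  assumes f: "f absolutely_integrable_on {a..b}" and g: "continuous_on {a..b} g"
  shows "(\<lambda>t. f t * g t) absolutely_integrable_on {a..b}"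
proof -
  have "(\<lambda>t. g t * f t) absolutely_integrable_on {a..b}"
  proof (rule absolutely_integrable_bounded_measurable_product[OF bilinear_times])
    show "g \<in> borel_measurable (lebesgue_on {a..b})"
      by (rule continuous_imp_measurable_on_sets_lebesgue[OF g]) simp
    show "bounded (g ` {a..b})"
      by (intro compact_imp_bounded compact_continuous_image g compact_Icc)
  qed (use f in auto)
  thus ?thesis by (simp add: mult.commute)
qed

lemma sum_integral_disjoint_intervals_le:
  fixes r :: "real \<Rightarrow> real" and k :: nat
  assumes r: "r integrable_on {a..b}" and nonneg: "\<And>t. t \<in> {a..b} \<Longrightarrow> 0 \<le> r t"
    and cd: "\<And>i. i < k \<Longrightarrow> a \<le> c i \<and> c i \<le> d i \<and> d i \<le> b"
    and disj: "\<And>i j. \<lbrakk>i < k; j < k; i \<noteq> j\<rbrakk> \<Longrightarrow> {c i<..<d i} \<inter> {c j<..<d j} = {}"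
  shows "(\<Sum>i<k. integral {c i..d i} r) \<le> integral {a..b} r"
proof -
  have hi: "((\<lambda>t. if t \<in> {c i<..<d i} then r t else 0) has_integral integral {c i..d i} r) {a..b}"
    if "i < k" for i
  proof -
    have "r integrable_on {c i..d i}"
      by (rule integrable_on_subinterval[OF r]) (use cd[OF that] in auto)
    hence "(r has_integral integral {c i..d i} r) {c i<..<d i}"
      by (simp add: integrable_integral flip: has_integral_Icc_iff_Ioo)
    thus ?thesis
      by (subst has_integral_restrict) (use cd[OF that] in auto)
  qed
  have "((\<lambda>t. \<Sum>i<k. if t \<in> {c i<..<d i} then r t else 0) has_integral (\<Sum>i<k. integral {c i..d i} r)) {a..b}"
    by (rule has_integral_sum) (use hi in auto)
  moreover have "(\<Sum>i<k. if t \<in> {c i<..<d i} then r t else 0) \<le> r t" if t: "t \<in> {a..b}" for t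
  proof (cases "\<exists>i<k. t \<in> {c i<..<d i}")
    case True
    then obtain i where i: "i < k" "t \<in> {c i<..<d i}" by blast
    have "(\<Sum>j<k. if t \<in> {c j<..<d j} then r t else 0) = (\<Sum>j<k. if j = i then r t else 0)"
    proof (rule sum.cong[OF refl])
      fix j assume "j \<in> {..<k}"
      thus "(if t \<in> {c j<..<d j} then r t else 0) = (if j = i then r t else 0)"
        using disj[of i j] i by (cases "j = i") auto
    qed
    thus ?thesis using i by simp
  next
    case False
    hence "(\<Sum>i<k. if t \<in> {c i<..<d i} then r t else 0) = 0" by (intro sum.neutral) auto
    thus ?thesis using nonneg[OF t] by simp
  qed
  ultimately show ?thesis
    by (rule has_integral_le[OF _ integrable_integral[OF r]])
qed

lemma indefinite_integral_diff:
  fixes f :: "real \<Rightarrow> 'b::euclidean_space"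
  assumes "f integrable_on {a..b}" "a \<le> c" "c \<le> d" "d \<le> b"
  shows "integral {a..d} f - integral {a..c} f = integral {c..d} f"
proof -
  have "f integrable_on {a..d}" by (rule integrable_on_subinterval[OF assms(1)]) (use assms in auto)
  thus ?thesis
    using Henstock_Kurzweil_Integration.integral_combine[of a c d f] assms by (simp add: algebra_simps)
qed

text \<open>Truncating at a high level changes the integral by little. Below the level the integral over
  a set is bounded by a multiple of the measure, which gives the absolute continuity of the integral.\<close>
lemma integral_truncation_small:
  fixes h :: "real \<Rightarrow> real"
  assumes h: "h absolutely_integrable_on {a..b}" and nonneg: "\<And>t. 0 \<le> h t" and e: "e > 0"
  obtains M :: nat where "(\<lambda>t. h t - min (h t) M) integrable_on {a..b}"
    "integral {a..b} (\<lambda>t. h t - min (h t) M) < e"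
proof -
  have int: "(\<lambda>t. h t - min (h t) (real M)) integrable_on {a..b}" for M
  proof -
    have "(\<lambda>t. real M) absolutely_integrable_on {a..b}"
      by (intro absolutely_integrable_continuous_real continuous_intros)
    hence "(\<lambda>t. min (h t) (real M)) absolutely_integrable_on {a..b}"
      by (rule absolutely_integrable_min_1[OF h])
    thus ?thesis using h by (intro integrable_diff) (auto simp: absolutely_integrable_on_def)
  qed
  have "(\<lambda>M. integral {a..b} (\<lambda>t. h t - min (h t) (real M))) \<longlonglongrightarrow> integral {a..b} (\<lambda>t. 0::real)"
  proof (rule dominated_convergence(2)[OF int])
    show "h integrable_on {a..b}" using h by (simp add: absolutely_integrable_on_def)
    show "norm (h t - min (h t) (real M)) \<le> h t" for t M using nonneg[of t] by (auto simp: min_def)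
    show "(\<lambda>M. h t - min (h t) (real M)) \<longlonglongrightarrow> 0" for t
    proof (rule tendsto_eventually)
      obtain M0 :: nat where "h t \<le> real M0" using real_arch_simple by blast
      thus "\<forall>\<^sub>F M in sequentially. h t - min (h t) (real M) = 0"
        unfolding eventually_sequentially by (intro exI[of _ M0]) (auto simp: min_def)
    qed
  qed
  hence "\<forall>\<^sub>F M in sequentially. integral {a..b} (\<lambda>t. h t - min (h t) (real M)) < e"
    using e by (intro order_tendstoD(2)) auto
  then obtain M where "integral {a..b} (\<lambda>t. h t - min (h t) (real M)) < e"
    unfolding eventually_sequentially by blast
  thus ?thesis using that int by blast
qed

lemma abs_continuous_indefinite_integral:
  fixes f :: "real \<Rightarrow> 'b::euclidean_space"
  assumes f: "f absolutely_integrable_on {a..b}"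
  shows "abs_continuous a b (\<lambda>t. integral {a..t} f)"
  unfolding abs_continuous_def
proof (intro allI impI)
  fix e :: real assume e: "e > 0"
  define h where "h t = norm (f t)" for t
  have fint: "f integrable_on {a..b}" and hint: "h integrable_on {a..b}"
    using f by (auto simp: absolutely_integrable_on_def h_def[abs_def])
  have "h absolutely_integrable_on {a..b}"
    using absolutely_integrable_norm[OF f] by (simp add: h_def[abs_def] o_def)
  then obtain M :: nat where rint: "(\<lambda>t. h t - min (h t) M) integrable_on {a..b}"
    and M: "integral {a..b} (\<lambda>t. h t - min (h t) M) < e / 2"
    using integral_truncation_small[where h = h and a = a and b = b and e = "e / 2"] e by (auto simp: h_def)
  define r where "r t = h t - min (h t) M" for t
  have r: "r integrable_on {a..b}" "\<And>t. 0 \<le> r t" "integral {a..b} r < e / 2"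
    using rint M by (auto simp: r_def[abs_def])
  show "\<exists>\<delta>>0. \<forall>(k::nat) c d.
        (\<forall>i<k. a \<le> c i \<and> c i \<le> d i \<and> d i \<le> b) \<and>
        (\<forall>i<k. \<forall>j<k. i \<noteq> j \<longrightarrow> {c i<..<d i} \<inter> {c j<..<d j} = {}) \<and>
        (\<Sum>i<k. d i - c i) < \<delta>
        \<longrightarrow> (\<Sum>i<k. norm (integral {a..d i} f - integral {a..c i} f)) < e"
  \<comment> \<open>The part of \<open>norm f\<close> below level \<open>M\<close> contributes at most \<open>M\<close> times the total length, the part \<open>r\<close>
    above it at most \<open>e / 2\<close>; the summand 1 only keeps the denominator positive.\<close>
  proof (intro exI[of _ "e / (2 * (M + 1))"] conjI allI impI)
    show "e / (2 * (M + 1)) > 0" using e by simp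
    fix k :: nat and c d :: "nat \<Rightarrow> real"
    assume H: "(\<forall>i<k. a \<le> c i \<and> c i \<le> d i \<and> d i \<le> b) \<and>
        (\<forall>i<k. \<forall>j<k. i \<noteq> j \<longrightarrow> {c i<..<d i} \<inter> {c j<..<d j} = {}) \<and>
        (\<Sum>i<k. d i - c i) < e / (2 * (M + 1))"
    have "(\<Sum>i<k. norm (integral {a..d i} f - integral {a..c i} f))
        \<le> (\<Sum>i<k. M * (d i - c i) + integral {c i..d i} r)"
    proof (rule sum_mono)
      fix i assume "i \<in> {..<k}"
      hence i: "a \<le> c i" "c i \<le> d i" "d i \<le> b" using H by auto
      hence sub: "{c i..d i} \<subseteq> {a..b}" by auto
      have ri: "(\<lambda>t. real M + r t) integrable_on {c i..d i}"
        by (intro integrable_add integrable_on_subinterval[OF r(1) sub]) auto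
      have "norm (integral {a..d i} f - integral {a..c i} f) = norm (integral {c i..d i} f)"
        using indefinite_integral_diff[OF fint i] by simp
      also have "\<dots> \<le> integral {c i..d i} (\<lambda>t. real M + r t)"
        by (rule Henstock_Kurzweil_Integration.integral_norm_bound_integral[OF
              integrable_on_subinterval[OF fint sub] ri])
           (auto simp: r_def h_def)
      also have "\<dots> = M * (d i - c i) + integral {c i..d i} r"
        using integrable_on_subinterval[OF r(1) sub] i
        by (subst Henstock_Kurzweil_Integration.integral_add) auto
      finally show "norm (integral {a..d i} f - integral {a..c i} f) \<le> M * (d i - c i) + integral {c i..d i} r" .
    qed
    also have "\<dots> = M * (\<Sum>i<k. d i - c i) + (\<Sum>i<k. integral {c i..d i} r)"
      by (simp add: sum.distrib sum_distrib_left)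
    also have "\<dots> \<le> M * (e / (2 * (M + 1))) + integral {a..b} r"
      using H by (intro add_mono mult_left_mono sum_integral_disjoint_intervals_le r) auto
    also have "\<dots> < e / 2 + e / 2"
    proof (rule add_le_less_mono)
      show "M * (e / (2 * (M + 1))) \<le> e / 2" using e by (simp add: field_simps)
    qed (rule r(3))
    finally show "(\<Sum>i<k. norm (integral {a..d i} f - integral {a..c i} f)) < e" by simp
  qed
qed

text \<open>The averages over the intervals to the right of a point converge almost everywhere; applied to
  the reflected function, the same fact gives the averages to the left.\<close>
lemma indefinite_integral_has_vector_derivative_AE:
  fixes f :: "real \<Rightarrow> 'b::euclidean_space"
  assumes f: "f integrable_on {a..b}"
  shows "AE t in lebesgue. t \<in> {a..b} \<longrightarrow>
           ((\<lambda>t. integral {a..t} f) has_vector_derivative f t) (at t)"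
proof -
  define g where "g t = (if t \<in> {a..b} then f t else 0)" for t
  have "g integrable_on UNIV"
    unfolding g_def using f by (subst Henstock_Kurzweil_Integration.integrable_restrict_UNIV)
  hence gint: "g integrable_on cbox u v" for u v
    by (rule integrable_on_subcbox) simp
  have "(\<lambda>t. g (- t)) integrable_on cbox u v" for u v
    using gint[of "- v" "- u"] by (metis Henstock_Kurzweil_Integration.integrable_reflect_real add.inverse_inverse box_real(2))
  then obtain N2 where N2: "negligible N2" and D2: "\<And>x e. \<lbrakk>x \<notin> N2; 0 < e\<rbrakk> \<Longrightarrow>
      \<exists>d>0. \<forall>h. 0 < h \<and> h < d \<longrightarrow>
        norm (integral (cbox x (x + h *\<^sub>R One)) (\<lambda>t. g (- t)) /\<^sub>R h ^ DIM(real) - g (- x)) < e"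
    using integrable_ccontinuous_explicit[of "\<lambda>t. g (- t)"] by blast
  obtain N1 where N1: "negligible N1" and D1: "\<And>x e. \<lbrakk>x \<notin> N1; 0 < e\<rbrakk> \<Longrightarrow>
      \<exists>d>0. \<forall>h. 0 < h \<and> h < d \<longrightarrow>
        norm (integral (cbox x (x + h *\<^sub>R One)) g /\<^sub>R h ^ DIM(real) - g x) < e"
    using integrable_ccontinuous_explicit[OF gint] by blast
  define N where "N = N1 \<union> uminus ` N2 \<union> {a, b}"
  have "negligible N"
    unfolding N_def using N1 N2 by (intro negligible_Un negligible_differentiable_image_negligible)
      (auto intro!: derivative_intros differentiable_on_minus)
  moreover have "((\<lambda>t. integral {a..t} f) has_vector_derivative f x) (at x)"
    if x: "x \<notin> N" "x \<in> {a..b}" for x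
  proof -
    have ab: "a < x" "x < b" using x by (auto simp: N_def less_le)
    have nN: "x \<notin> N1" "- x \<notin> N2" using x by (force simp: N_def)+
    have gx: "g x = f x" using x by (simp add: g_def)
    show ?thesis
      unfolding has_vector_derivative_def has_derivative_at_alt
    proof (intro conjI allI impI bounded_linear_scaleR_left)
      fix e :: real assume e: "e > 0"
      obtain d1 where d1: "d1 > 0" "\<And>h. 0 < h \<and> h < d1 \<Longrightarrow>
          norm (integral {x..x + h} g /\<^sub>R h - g x) < e"
        using D1[OF nN(1) e] by auto
      obtain d2 where d2: "d2 > 0" "\<And>h. 0 < h \<and> h < d2 \<Longrightarrow>
          norm (integral {- x..- x + h} (\<lambda>t. g (- t)) /\<^sub>R h - g x) < e"
        using D2[OF nN(2) e] by auto
      have scale: "norm (I - h *\<^sub>R g x) \<le> e * h" if "h > 0" "norm (I /\<^sub>R h - g x) < e" for I :: 'b and h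
      proof -
        have "I - h *\<^sub>R g x = h *\<^sub>R (I /\<^sub>R h - g x)" using that by (simp add: scaleR_diff_right)
        hence "norm (I - h *\<^sub>R g x) = h * norm (I /\<^sub>R h - g x)" using that by simp
        thus ?thesis using that by (simp add: mult.commute)
      qed
      have geq: "integral {u..v} g = integral {u..v} f" if "a \<le> u" "v \<le> b" for u v
        by (rule Henstock_Kurzweil_Integration.integral_cong) (use that in \<open>auto simp: g_def\<close>)
      show "\<exists>d>0. \<forall>y. norm (y - x) < d \<longrightarrow>
          norm (integral {a..y} f - integral {a..x} f - (y - x) *\<^sub>R f x) \<le> e * norm (y - x)"
      proof (intro exI[of _ "min (min d1 d2) (min (x - a) (b - x))"] conjI allI impI)
        fix y assume y: "norm (y - x) < min (min d1 d2) (min (x - a) (b - x))"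
        show "norm (integral {a..y} f - integral {a..x} f - (y - x) *\<^sub>R f x) \<le> e * norm (y - x)"
        proof (cases y x rule: linorder_cases)
          case equal thus ?thesis by simp
        next
          case greater
          have "integral {a..y} f - integral {a..x} f = integral {x..x + (y - x)} g"
            using indefinite_integral_diff[OF f, of x y] geq[of x y] ab y greater by auto
          moreover have "norm (integral {x..x + (y - x)} g - (y - x) *\<^sub>R g x) \<le> e * (y - x)"
            by (rule scale[OF _ d1(2)]) (use greater y in auto)
          ultimately show ?thesis using greater gx by simp
        next
          case less
          have "integral {- x..- y} (\<lambda>t. g (- t)) = integral {y..x} g" by simp
          hence "integral {a..x} f - integral {a..y} f = integral {- x..- x + (x - y)} (\<lambda>t. g (- t))"
            using indefinite_integral_diff[OF f, of y x] geq[of y x] ab y less by auto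
          moreover have "norm (integral {- x..- x + (x - y)} (\<lambda>t. g (- t)) - (x - y) *\<^sub>R g x) \<le> e * (x - y)"
            by (rule scale[OF _ d2(2)]) (use less y in auto)
          ultimately have "norm (integral {a..x} f - integral {a..y} f - (x - y) *\<^sub>R f x) \<le> e * (x - y)"
            using gx by simp
          moreover have "integral {a..y} f - integral {a..x} f - (y - x) *\<^sub>R f x
              = - (integral {a..x} f - integral {a..y} f - (x - y) *\<^sub>R f x)"
            by (simp add: algebra_simps)
          ultimately show ?thesis using less by (simp only: norm_minus_cancel) simp
        qed
      qed (use d1 d2 ab in auto)
    qed
  qed
  ultimately show ?thesis
    by (intro AE_I'[of N]) (auto simp: negligible_iff_null_sets)
qed

text \<open>Subtracting the indefinite integral of \<open>g\<close> leaves an absolutely continuous function with derivative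
  zero almost everywhere.\<close>
theorem abs_continuous_eq_integral:
  fixes f g :: "real \<Rightarrow> 'b::euclidean_space"
  assumes ac: "abs_continuous a b f" and g: "g absolutely_integrable_on {a..b}"
    and der: "AE t in lebesgue. t \<in> {a..b} \<longrightarrow> (f has_vector_derivative g t) (at t)"
    and t: "t \<in> {a..b}"
  shows "f t = f a + integral {a..t} g"
proof -
  have gint: "g integrable_on {a..b}" using g by (simp add: absolutely_integrable_on_def)
  have "abs_continuous a b (\<lambda>t. f t - integral {a..t} g)"
    by (intro abs_continuous_diff ac abs_continuous_indefinite_integral g)
  moreover have "AE t in lebesgue. t \<in> {a..b} \<longrightarrow>
      ((\<lambda>t. f t - integral {a..t} g) has_vector_derivative 0) (at t)"
    using der indefinite_integral_has_vector_derivative_AE[OF gint]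
  proof eventually_elim
    case (elim t)
    thus ?case by (auto dest: has_vector_derivative_diff)
  qed
  ultimately have "f t - integral {a..t} g = f a - integral {a..a} g"
    by (rule abs_continuous_deriv_zero_imp_const) (rule t)
  thus ?thesis by (simp add: algebra_simps)
qed

section \<open>Linear differential equations with integrable coefficients\<close>

text \<open>The weight is \<open>E = exp (2 L)\<close> for the indefinite integral \<open>L\<close> of \<open>\<alpha>\<close>, since
  \<open>E' = 2 \<alpha> E\<close> almost everywhere. Measured relative to \<open>E\<close>, integration against \<open>\<alpha>\<close> halves
  the size of a function, on the whole interval at once.\<close>
lemma exponential_weight:
  fixes \<alpha> :: "real \<Rightarrow> real"
  assumes \<alpha>: "\<alpha> absolutely_integrable_on {a..b}" and nonneg: "\<And>t. 0 \<le> \<alpha> t"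
  shows "\<exists>E. continuous_on {a..b} E \<and> (\<forall>t\<in>{a..b}. 1 \<le> E t) \<and>
    (\<forall>t\<in>{a..b}. integral {a..t} (\<lambda>s. \<alpha> s * E s) \<le> E t / 2)"
proof -
  have \<alpha>int: "\<alpha> integrable_on {a..b}" using \<alpha> by (simp add: absolutely_integrable_on_def)
  define L where "L t = integral {a..t} \<alpha>" for t
  define E where "E t = exp (2 * L t)" for t
  have mono: "L s \<le> L t" if "a \<le> s" "s \<le> t" "t \<le> b" for s t
  proof -
    have "L t - L s = integral {s..t} \<alpha>"
      unfolding L_def by (rule indefinite_integral_diff[OF \<alpha>int that])
    also have "\<dots> \<ge> 0" using nonneg by (intro Henstock_Kurzweil_Integration.integral_nonneg
          integrable_on_subinterval[OF \<alpha>int]) (use that in auto)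
    finally show ?thesis by simp
  qed
  have "L a = 0" by (simp add: L_def)
  have "abs_continuous a b L"
    unfolding L_def[abs_def] by (rule abs_continuous_indefinite_integral[OF \<alpha>])
  hence ac: "abs_continuous a b E"
  proof (rule abs_continuous_compose_lipschitz)
    fix s t :: real assume st: "a \<le> s" "s \<le> t" "t \<le> b"
    have L: "L s \<le> L t" "L t \<le> L b" using mono st by auto
    have "exp (2 * L s) = exp (2 * L t) * exp (2 * L s - 2 * L t)" by (simp flip: exp_add)
    also have "\<dots> \<ge> exp (2 * L t) * (1 + (2 * L s - 2 * L t))"
      by (intro mult_left_mono exp_ge_add_one_self) auto
    finally have "E t - E s \<le> exp (2 * L t) * (2 * (L t - L s))"
      by (simp add: E_def algebra_simps)
    also have "\<dots> \<le> exp (2 * L b) * (2 * (L t - L s))" using L by (intro mult_right_mono) auto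
    finally have "E t - E s \<le> (2 * exp (2 * L b)) * (L t - L s)" by (simp add: algebra_simps)
    moreover have "E s \<le> E t" using L by (simp add: E_def)
    ultimately show "norm (E t - E s) \<le> (2 * exp (2 * L b)) * norm (L t - L s)" using L by simp
  qed
  hence cont: "continuous_on {a..b} E" by (rule abs_continuous_imp_continuous_on)
  have int: "(\<lambda>s. \<alpha> s * (2 * E s)) absolutely_integrable_on {a..b}"
    by (intro absolutely_integrable_mult_continuous \<alpha> continuous_intros cont)
  have der: "AE t in lebesgue. t \<in> {a..b} \<longrightarrow> (E has_vector_derivative \<alpha> t * (2 * E t)) (at t)"
    using indefinite_integral_has_vector_derivative_AE[OF \<alpha>int]
  proof eventually_elim
    case (elim t)
    show ?case
    proof
      assume "t \<in> {a..b}"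
      with elim have "(L has_real_derivative \<alpha> t) (at t)"
        unfolding L_def[abs_def] by (simp add: has_real_derivative_iff_has_vector_derivative)
      from DERIV_fun_exp[OF DERIV_cmult[OF this, of 2]]
      have "(E has_real_derivative \<alpha> t * (2 * E t)) (at t)"
        by (simp add: E_def[abs_def] mult_ac)
      thus "(E has_vector_derivative \<alpha> t * (2 * E t)) (at t)"
        by (simp add: has_real_derivative_iff_has_vector_derivative)
    qed
  qed
  show ?thesis
  proof (intro exI[of _ E] conjI ballI)
    show "continuous_on {a..b} E" by (rule cont)
    show "1 \<le> E t" if "t \<in> {a..b}" for t
      using mono[of a t] that \<open>L a = 0\<close> by (simp add: E_def)
    show "integral {a..t} (\<lambda>s. \<alpha> s * E s) \<le> E t / 2" if t: "t \<in> {a..b}" for t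
    proof -
      have "E t = E a + integral {a..t} (\<lambda>s. \<alpha> s * (2 * E s))"
        by (rule abs_continuous_eq_integral[OF ac int der t])
      also have "(\<lambda>s. \<alpha> s * (2 * E s)) = (\<lambda>s. 2 * (\<alpha> s * E s))" by (simp add: mult.left_commute)
      also have "integral {a..t} \<dots> = 2 * integral {a..t} (\<lambda>s. \<alpha> s * E s)"
        by (rule Henstock_Kurzweil_Integration.integral_mult_right)
      finally show ?thesis by (simp add: E_def \<open>L a = 0\<close>)
    qed
  qed
qed

locale linear_ode =
  fixes n :: nat and A :: "nat \<Rightarrow> nat \<Rightarrow> real \<Rightarrow> 'a::{real_normed_field, euclidean_space}" and a b :: real
  assumes A: "\<And>i j. \<lbrakk>i < n; j < n\<rbrakk> \<Longrightarrow> A i j absolutely_integrable_on {a..b}"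
begin

definition rhs :: "(nat \<Rightarrow> real \<Rightarrow> 'a) \<Rightarrow> nat \<Rightarrow> real \<Rightarrow> 'a" where
  "rhs x i t = (\<Sum>j<n. A i j t * x j t)"

lemma rhs_absolutely_integrable:
  assumes "i < n" "\<And>j. j < n \<Longrightarrow> continuous_on {a..b} (x j)"
  shows "rhs x i absolutely_integrable_on {a..b}"
  unfolding rhs_def[abs_def]
  by (intro absolutely_integrable_sum absolutely_integrable_mult_continuous A assms) auto

lemma rhs_integrable:
  assumes "i < n" "\<And>j. j < n \<Longrightarrow> continuous_on {a..b} (x j)" "t \<in> {a..b}"
  shows "rhs x i integrable_on {a..t}"
proof (rule integrable_on_subinterval)
  show "rhs x i integrable_on {a..b}"
    using rhs_absolutely_integrable[OF assms(1,2)] by (simp add: absolutely_integrable_on_def)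
qed (use assms(3) in auto)

definition coeff_norm :: "real \<Rightarrow> real" where
  "coeff_norm t = (\<Sum>i<n. \<Sum>j<n. norm (A i j t))"

lemma norm_A_absolutely_integrable:
  "\<lbrakk>i < n; j < n\<rbrakk> \<Longrightarrow> (\<lambda>t. norm (A i j t)) absolutely_integrable_on {a..b}"
  using absolutely_integrable_norm[OF A] by (simp add: o_def)

text \<open>With respect to the weighted supremum norm given by \<open>E\<close>, the integral operator of the equation is a
  contraction with factor \<open>1/2\<close>; \<open>K\<close> plays the role of the norm of \<open>x\<close>.\<close>
definition halving_weight :: "(real \<Rightarrow> real) \<Rightarrow> bool" where
  "halving_weight E \<longleftrightarrow> continuous_on {a..b} E \<and> (\<forall>t\<in>{a..b}. 1 \<le> E t) \<and>
     (\<forall>x K. (\<forall>j<n. continuous_on {a..b} (x j)) \<and> 0 \<le> K \<and>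
        (\<forall>s\<in>{a..b}. (\<Sum>j<n. norm (x j s)) \<le> K * E s) \<longrightarrow>
        (\<forall>t\<in>{a..b}. (\<Sum>i<n. norm (integral {a..t} (rhs x i))) \<le> K / 2 * E t))"

lemma halving_weightD:
  assumes "halving_weight E"
  shows "continuous_on {a..b} E" "\<And>t. t \<in> {a..b} \<Longrightarrow> 1 \<le> E t"
    "\<And>x K t. \<lbrakk>\<And>j. j < n \<Longrightarrow> continuous_on {a..b} (x j);
        \<And>s. s \<in> {a..b} \<Longrightarrow> (\<Sum>j<n. norm (x j s)) \<le> K * E s; 0 \<le> K; t \<in> {a..b}\<rbrakk>
      \<Longrightarrow> (\<Sum>i<n. norm (integral {a..t} (rhs x i))) \<le> K / 2 * E t"
  using assms unfolding halving_weight_def by auto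

lemma halving_weight_exists: "\<exists>E. halving_weight E"
proof -
  have "coeff_norm absolutely_integrable_on {a..b}"
    unfolding coeff_norm_def[abs_def] by (intro absolutely_integrable_sum norm_A_absolutely_integrable) auto
  moreover have "0 \<le> coeff_norm t" for t by (auto simp: coeff_norm_def intro!: sum_nonneg)
  ultimately obtain E where cont: "continuous_on {a..b} E" and ge1: "\<forall>t\<in>{a..b}. 1 \<le> E t"
    and half: "\<forall>t\<in>{a..b}. integral {a..t} (\<lambda>s. coeff_norm s * E s) \<le> E t / 2"
    using exponential_weight[of a b coeff_norm] by blast
  have "(\<Sum>i<n. norm (integral {a..t} (rhs x i))) \<le> K / 2 * E t"
    if x: "\<And>j. j < n \<Longrightarrow> continuous_on {a..b} (x j)"
      and bound: "\<And>s. s \<in> {a..b} \<Longrightarrow> (\<Sum>j<n. norm (x j s)) \<le> K * E s" and K: "0 \<le> K" and t: "t \<in> {a..b}"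
    for x :: "nat \<Rightarrow> real \<Rightarrow> 'a" and K t
  proof -
    have int: "(\<lambda>s. (\<Sum>j<n. norm (A i j s)) * (K * E s)) integrable_on {a..t}" if "i < n" for i
    proof -
      have "(\<lambda>s. (\<Sum>j<n. norm (A i j s)) * (K * E s)) absolutely_integrable_on {a..b}"
        by (intro absolutely_integrable_mult_continuous absolutely_integrable_sum
              norm_A_absolutely_integrable continuous_intros cont) (use that in auto)
      thus ?thesis
        by (rule integrable_on_subinterval[OF set_lebesgue_integral_eq_integral(1)]) (use t in auto)
    qed
    have "(\<Sum>i<n. norm (integral {a..t} (rhs x i)))
        \<le> (\<Sum>i<n. integral {a..t} (\<lambda>s. (\<Sum>j<n. norm (A i j s)) * (K * E s)))"
    proof (rule sum_mono, rule Henstock_Kurzweil_Integration.integral_norm_bound_integral)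
      fix i s assume i: "i \<in> {..<n}" and s: "s \<in> {a..t}"
      hence s': "s \<in> {a..b}" using t by auto
      have le: "norm (x j s) \<le> K * E s" if "j < n" for j
      proof -
        have "norm (x j s) \<le> (\<Sum>j<n. norm (x j s))" by (rule member_le_sum) (use that in auto)
        thus ?thesis using bound[OF s'] by simp
      qed
      have "norm (rhs x i s) \<le> (\<Sum>j<n. norm (A i j s) * norm (x j s))"
        unfolding rhs_def by (intro order.trans[OF norm_sum] sum_mono) (simp add: norm_mult)
      also have "\<dots> \<le> (\<Sum>j<n. norm (A i j s) * (K * E s))"
        by (intro sum_mono mult_left_mono le) auto
      finally show "norm (rhs x i s) \<le> (\<Sum>j<n. norm (A i j s)) * (K * E s)"
        by (simp add: sum_distrib_right)
    qed (use int rhs_integrable[OF _ x t] in auto)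
    also have "\<dots> = integral {a..t} (\<lambda>s. \<Sum>i<n. (\<Sum>j<n. norm (A i j s)) * (K * E s))"
      by (rule Henstock_Kurzweil_Integration.integral_sum[symmetric]) (use int in auto)
    also have "(\<lambda>s. \<Sum>i<n. (\<Sum>j<n. norm (A i j s)) * (K * E s)) = (\<lambda>s. K * (coeff_norm s * E s))"
      by (simp only: coeff_norm_def sum_distrib_right[symmetric]) (simp add: mult_ac)
    also have "integral {a..t} \<dots> = K * integral {a..t} (\<lambda>s. coeff_norm s * E s)"
      by (rule Henstock_Kurzweil_Integration.integral_mult_right)
    also have "\<dots> \<le> K * (E t / 2)" using bspec[OF half t] K by (rule mult_left_mono)
    finally show ?thesis by simp
  qed
  with cont ge1 have "halving_weight E" unfolding halving_weight_def by auto
  thus ?thesis by blast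
qed

text \<open>A solution of the homogeneous integral equation is reproduced by an operator that halves its
  weighted norm, so this norm is zero.\<close>
lemma integral_equation_unique:
  assumes cont: "\<And>i. i < n \<Longrightarrow> continuous_on {a..b} (z i)"
    and eq: "\<And>i t. \<lbrakk>i < n; t \<in> {a..b}\<rbrakk> \<Longrightarrow> z i t = integral {a..t} (rhs z i)"
    and i: "i < n" and t: "t \<in> {a..b}"
  shows "z i t = 0"
proof -
  obtain E where "halving_weight E" using halving_weight_exists by blast
  note E = halving_weightD[OF this]
  have Epos: "E t > 0" if "t \<in> {a..b}" for t using E(2)[OF that] by simp
  define g where "g t = (\<Sum>i<n. norm (z i t)) / E t" for t
  have "continuous_on {a..b} g"
    unfolding g_def[abs_def] using Epos
    by (intro continuous_intros cont E) (force)+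
  then obtain s where s: "s \<in> {a..b}" and max: "\<And>t. t \<in> {a..b} \<Longrightarrow> g t \<le> g s"
    using continuous_attains_sup[of "{a..b}" g] t by auto
  have "(\<Sum>i<n. norm (z i s)) = (\<Sum>i<n. norm (integral {a..s} (rhs z i)))"
    using eq s by (intro sum.cong) auto
  also have "\<dots> \<le> g s / 2 * E s"
  proof (rule E(3)[OF cont _ _ s])
    show "(\<Sum>j<n. norm (z j t)) \<le> g s * E t" if "t \<in> {a..b}" for t
      using max[OF that] Epos[OF that] by (simp add: g_def pos_divide_le_eq)
    show "0 \<le> g s" using Epos[OF s] by (simp add: g_def sum_nonneg)
  qed auto
  finally have "g s \<le> g s / 2" using Epos[OF s] by (simp add: g_def pos_divide_le_eq)
  hence "g t \<le> 0" using max[OF t] by simp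
  hence "(\<Sum>i<n. norm (z i t)) \<le> 0" using Epos[OF t] by (simp add: g_def divide_le_0_iff)
  moreover have "norm (z i t) \<le> (\<Sum>i<n. norm (z i t))" by (rule member_le_sum) (use i in auto)
  ultimately have "norm (z i t) \<le> 0" by linarith
  thus ?thesis by simp
qed

text \<open>The terms of the Neumann series of the integral operator, started at the constant function \<open>c\<close>.\<close>
primrec peano_baker :: "(nat \<Rightarrow> 'a) \<Rightarrow> nat \<Rightarrow> nat \<Rightarrow> real \<Rightarrow> 'a" where
  "peano_baker c 0 i t = c i"
| "peano_baker c (Suc k) i t = integral {a..t} (rhs (peano_baker c k) i)"

lemma continuous_on_peano_baker: "i < n \<Longrightarrow> continuous_on {a..b} (peano_baker c k i)"
proof (induction k arbitrary: i)
  case (Suc k)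
  have "rhs (peano_baker c k) i integrable_on {a..b}"
    using rhs_absolutely_integrable[OF Suc.prems Suc.IH] by (auto simp: absolutely_integrable_on_def)
  thus ?case by (simp add: indefinite_integral_continuous_1)
qed (simp add: continuous_on_const)

text \<open>The series of the Peano-Baker terms is dominated by a geometric series, because each step
  halves the weighted norm. Its uniform limit solves the equation by dominated convergence.\<close>
lemma integral_equation_exists:
  obtains x where "\<And>i. i < n \<Longrightarrow> continuous_on {a..b} (x i)"
    "\<And>i t. \<lbrakk>i < n; t \<in> {a..b}\<rbrakk> \<Longrightarrow> x i t = c i + integral {a..t} (rhs x i)"
proof -
  obtain E where "halving_weight E" using halving_weight_exists by blast
  note E = halving_weightD[OF this]
  let ?D = "peano_baker c"
  define K where "K = (\<Sum>i<n. norm (c i))"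
  have K: "0 \<le> K" by (simp add: K_def sum_nonneg)
  have bound: "(\<Sum>i<n. norm (?D k i t)) \<le> K * (1/2) ^ k * E t" if "t \<in> {a..b}" for k t
    using that
  proof (induction k arbitrary: t)
    case 0
    show ?case using mult_left_mono[OF E(2)[OF 0] K] by (simp add: K_def)
  next
    case (Suc k)
    have "(\<Sum>i<n. norm (?D (Suc k) i t)) \<le> K * (1/2) ^ k / 2 * E t"
      unfolding peano_baker.simps
      by (rule E(3)[OF continuous_on_peano_baker]) (use Suc K in auto)
    thus ?case by simp
  qed
  have "bounded (E ` {a..b})" by (intro compact_imp_bounded compact_continuous_image E compact_Icc)
  then obtain B where "\<And>t. t \<in> {a..b} \<Longrightarrow> norm (E t) \<le> B" unfolding bounded_iff by blast
  hence B: "\<And>t. t \<in> {a..b} \<Longrightarrow> E t \<le> B" by fastforce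
  define M where "M k = K * B * (1/2) ^ k" for k :: nat
  have D_le: "norm (?D k i t) \<le> M k" if "i < n" "t \<in> {a..b}" for k i t
  proof -
    have "norm (?D k i t) \<le> (\<Sum>i<n. norm (?D k i t))" by (rule member_le_sum) (use that in auto)
    also have "\<dots> \<le> K * (1/2) ^ k * E t" by (rule bound) (rule that)
    also have "\<dots> \<le> K * (1/2) ^ k * B" using B that K by (intro mult_left_mono) auto
    finally show ?thesis by (simp add: M_def mult.commute mult.left_commute)
  qed
  have sumM: "summable M" unfolding M_def[abs_def] by (intro summable_mult summable_geometric) simp
  define x where "x i t = (\<Sum>k. ?D k i t)" for i t
  define S where "S N i t = (\<Sum>k<N. ?D k i t)" for N i t
  have unif: "uniform_limit {a..b} (\<lambda>N t. S N i t) (x i) sequentially" if "i < n" for i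
    unfolding S_def x_def by (rule Weierstrass_m_test[OF _ sumM]) (rule D_le[OF that])
  have S_cont: "continuous_on {a..b} (S N i)" if "i < n" for N i
    unfolding S_def[abs_def] by (intro continuous_intros continuous_on_peano_baker that)
  have x_cont: "continuous_on {a..b} (x i)" if "i < n" for i
    by (rule uniform_limit_theorem[OF _ unif[OF that]]) (use S_cont[OF that] in auto)
  have S_le: "norm (S N i t) \<le> suminf M" if "i < n" "t \<in> {a..b}" for N i t
  proof -
    have Mnn: "0 \<le> M k" for k using D_le[OF that, of k] norm_ge_zero order_trans by blast
    have "norm (S N i t) \<le> (\<Sum>k<N. M k)"
      unfolding S_def by (intro order.trans[OF norm_sum] sum_mono D_le that)
    also have "\<dots> \<le> suminf M" by (rule sum_le_suminf[OF sumM]) (use Mnn in auto)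
    finally show ?thesis .
  qed
  have S_Suc: "S (Suc N) i t = c i + integral {a..t} (rhs (S N) i)" if "i < n" "t \<in> {a..b}" for N i t
  proof -
    have "S (Suc N) i t = c i + (\<Sum>k<N. integral {a..t} (rhs (?D k) i))"
      unfolding S_def by (simp only: sum.lessThan_Suc_shift peano_baker.simps)
    also have "(\<Sum>k<N. integral {a..t} (rhs (?D k) i)) = integral {a..t} (\<lambda>s. \<Sum>k<N. rhs (?D k) i s)"
      by (rule Henstock_Kurzweil_Integration.integral_sum[symmetric])
         (use rhs_integrable[OF that(1) continuous_on_peano_baker that(2)] in auto)
    also have "(\<lambda>s. \<Sum>k<N. rhs (?D k) i s) = rhs (S N) i"
      unfolding rhs_def[abs_def] S_def by (subst sum.swap) (simp add: sum_distrib_left)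
    finally show ?thesis .
  qed
  have "x i t = c i + integral {a..t} (rhs x i)" if i: "i < n" and t: "t \<in> {a..b}" for i t
  proof (rule LIMSEQ_unique)
    have lim: "(\<lambda>N. S N j s) \<longlonglongrightarrow> x j s" if "j < n" "s \<in> {a..b}" for j s
      using unif[OF that(1)] that(2) by (rule tendsto_uniform_limitI)
    show "(\<lambda>N. S (Suc N) i t) \<longlonglongrightarrow> x i t" by (rule LIMSEQ_Suc[OF lim[OF i t]])
    have "(\<lambda>N. integral {a..t} (rhs (S N) i)) \<longlonglongrightarrow> integral {a..t} (rhs x i)"
    proof (rule dominated_convergence(2))
      show "rhs (S N) i integrable_on {a..t}" for N by (rule rhs_integrable[OF i S_cont t])
      have "(\<lambda>s. (\<Sum>j<n. norm (A i j s)) * suminf M) absolutely_integrable_on {a..b}"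
        by (intro absolutely_integrable_mult_continuous absolutely_integrable_sum
              norm_A_absolutely_integrable continuous_intros) (use i in auto)
      thus "(\<lambda>s. (\<Sum>j<n. norm (A i j s)) * suminf M) integrable_on {a..t}"
        by (rule integrable_on_subinterval[OF set_lebesgue_integral_eq_integral(1)]) (use t in auto)
      fix s assume s: "s \<in> {a..t}"
      hence s': "s \<in> {a..b}" using t by auto
      show "norm (rhs (S N) i s) \<le> (\<Sum>j<n. norm (A i j s)) * suminf M" for N
      proof -
        have "norm (rhs (S N) i s) \<le> (\<Sum>j<n. norm (A i j s) * norm (S N j s))"
          unfolding rhs_def by (intro order.trans[OF norm_sum] sum_mono) (simp add: norm_mult)
        also have "\<dots> \<le> (\<Sum>j<n. norm (A i j s) * suminf M)"
          by (intro sum_mono mult_left_mono S_le s') auto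
        finally show ?thesis by (simp add: sum_distrib_right)
      qed
      show "(\<lambda>N. rhs (S N) i s) \<longlonglongrightarrow> rhs x i s"
        unfolding rhs_def by (intro tendsto_intros lim s') auto
    qed
    thus "(\<lambda>N. S (Suc N) i t) \<longlonglongrightarrow> c i + integral {a..t} (rhs x i)"
      unfolding S_Suc[OF i t] by (intro tendsto_intros)
  qed
  with x_cont show ?thesis by (rule that)
qed

end

section \<open>Supports of patterns and the graph condition\<close>

text \<open>Every pattern has this form, which turns pattern arithmetic into predicates on index pairs.\<close>
definition mats_with_support :: "nat \<Rightarrow> nat \<Rightarrow> (nat \<Rightarrow> nat \<Rightarrow> bool) \<Rightarrow> 'a::zero mat set" where
  "mats_with_support p q s = {X \<in> carrier_mat p q. \<forall>i<p. \<forall>j<q. X $$ (i, j) \<noteq> 0 \<longleftrightarrow> s i j}"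

lemma mats_with_supportD:
  assumes "X \<in> mats_with_support p q s"
  shows "X \<in> carrier_mat p q" "\<And>i j. \<lbrakk>i < p; j < q\<rbrakk> \<Longrightarrow> X $$ (i, j) \<noteq> 0 \<longleftrightarrow> s i j"
  using assms by (auto simp: mats_with_support_def)

lemma mats_with_support_cong:
  "(\<And>i j. \<lbrakk>i < p; j < q\<rbrakk> \<Longrightarrow> s i j \<longleftrightarrow> s' i j) \<Longrightarrow> mats_with_support p q s = mats_with_support p q s'"
  by (auto simp: mats_with_support_def)

lemma mats_with_support_nonempty: "(mats_with_support p q s :: 'a::zero_neq_one mat set) \<noteq> {}"
proof -
  have "mat p q (\<lambda>(i, j). if s i j then 1 else 0 :: 'a) \<in> mats_with_support p q s"
    by (auto simp: mats_with_support_def)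
  thus ?thesis by blast
qed

lemma pattern_of_eq:
  assumes "X \<in> carrier_mat p q"
  shows "pattern_of X = mats_with_support p q (\<lambda>i j. X $$ (i, j) \<noteq> 0)"
  using assms by (auto simp: pattern_of_def same_pattern_def mats_with_support_def)

lemma patterns_eq_mats_with_support:
  assumes "P \<in> patterns p q"
  shows "P = mats_with_support p q (pattern_star P)"
proof -
  obtain X where X: "X \<in> carrier_mat p q" "P = pattern_of X"
    using assms by (auto simp: patterns_def quotient_def pattern_of_def)
  hence P: "P = mats_with_support p q (\<lambda>i j. X $$ (i, j) \<noteq> 0)" by (simp add: pattern_of_eq)
  moreover have "X \<in> P" unfolding P using X by (simp add: mats_with_support_def)
  ultimately have "pattern_star P i j \<longleftrightarrow> X $$ (i, j) \<noteq> 0" if "i < p" "j < q" for i j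
    unfolding pattern_star_def using that by (auto simp: mats_with_support_def)
  with P show ?thesis by (simp cong: mats_with_support_cong)
qed

lemma patterns_memD:
  assumes "P \<in> patterns p q" "X \<in> P"
  shows "X \<in> carrier_mat p q" "\<lbrakk>i < p; j < q\<rbrakk> \<Longrightarrow> X $$ (i, j) \<noteq> 0 \<longleftrightarrow> pattern_star P i j"
  using mats_with_supportD[OF subsetD[OF equalityD1[OF patterns_eq_mats_with_support[OF assms(1)]] assms(2)]]
  by auto

lemma patterns_nonempty:
  assumes "P \<in> patterns p q"
  shows "P \<noteq> {}"
  using assms by (auto simp: patterns_def quotient_def same_pattern_def)

lemma UN_const_on: "P \<noteq> {} \<Longrightarrow> (\<And>X. X \<in> P \<Longrightarrow> f X = c) \<Longrightarrow> (\<Union>X\<in>P. f X) = c"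
  by auto

lemma pattern_add_one:
  fixes A :: "'a::real_normed_field mat set"
  assumes "A \<in> patterns n n"
  shows "pattern_add (pattern_of (1\<^sub>m n)) A = mats_with_support n n (\<lambda>i j. i = j \<or> pattern_star A i j)"
proof -
  have I: "pattern_of (1\<^sub>m n :: 'a mat) = mats_with_support n n (\<lambda>i j. (1\<^sub>m n :: 'a mat) $$ (i, j) \<noteq> 0)"
    by (rule pattern_of_eq) simp
  have "pattern_of (abs_mat X + abs_mat Y) = mats_with_support n n (\<lambda>i j. i = j \<or> pattern_star A i j)"
    if X: "X \<in> pattern_of (1\<^sub>m n)" and Y: "Y \<in> A" for X Y
  proof -
    note X' = mats_with_supportD[OF X[unfolded I]]
    note Y' = patterns_memD[OF assms Y]
    have "(abs_mat X + abs_mat Y) $$ (i, j) \<noteq> 0 \<longleftrightarrow> i = j \<or> pattern_star A i j" if ij: "i < n" "j < n" for i j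
    proof -
      have "(abs_mat X + abs_mat Y) $$ (i, j) = of_real (norm (X $$ (i, j)) + norm (Y $$ (i, j)))"
        using ij X'(1) Y'(1) by (simp add: abs_mat_def)
      hence "(abs_mat X + abs_mat Y) $$ (i, j) \<noteq> 0 \<longleftrightarrow> X $$ (i, j) \<noteq> 0 \<or> Y $$ (i, j) \<noteq> 0"
        by (simp add: add_nonneg_eq_0_iff del: of_real_add)
      thus ?thesis using X'(2)[OF ij] Y'(2)[OF ij] ij by simp
    qed
    moreover have "abs_mat X + abs_mat Y \<in> carrier_mat n n"
      using X' Y' by (simp add: abs_mat_def)
    ultimately show ?thesis by (simp add: pattern_of_eq cong: mats_with_support_cong)
  qed
  moreover have "pattern_of (1\<^sub>m n :: 'a mat) \<noteq> {}" "A \<noteq> {}"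
    using patterns_nonempty[OF assms] by (auto simp: I mats_with_support_nonempty)
  ultimately show ?thesis
    unfolding pattern_add_def by (intro UN_const_on) auto
qed

lemma index_mat_adjoint:
  assumes "X \<in> carrier_mat p q"
  shows "mat_adjoint X \<in> carrier_mat q p" "\<lbrakk>i < q; j < p\<rbrakk> \<Longrightarrow> mat_adjoint X $$ (i, j) = conjugate (X $$ (j, i))"
  using assms by (auto simp: mat_adjoint_def mat_of_rows_index)

lemma pattern_adjoint_mem:
  assumes "P \<in> patterns p q" "Y \<in> pattern_adjoint P"
  shows "Y \<in> carrier_mat q p"
proof -
  obtain X where X: "X \<in> P" "Y \<in> pattern_of (mat_adjoint X)"
    using assms(2) by (auto simp: pattern_adjoint_def)
  have "X \<in> carrier_mat p q" by (rule patterns_memD(1)[OF assms(1) X(1)])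
  hence "mat_adjoint X \<in> carrier_mat q p" by (rule index_mat_adjoint(1))
  from X(2)[unfolded pattern_of_eq[OF this]] show ?thesis by (rule mats_with_supportD(1))
qed

lemma pattern_star_adjoint:
  assumes P: "P \<in> patterns p q" and ij: "i < q" "j < p"
  shows "pattern_star (pattern_adjoint P) i j \<longleftrightarrow> pattern_star P j i"
proof -
  have X: "(\<exists>Y\<in>pattern_of (mat_adjoint X). Y $$ (i, j) \<noteq> 0) \<longleftrightarrow> X $$ (j, i) \<noteq> 0" if "X \<in> P" for X
  proof -
    have c: "X \<in> carrier_mat p q" by (rule patterns_memD(1)[OF P that])
    note a = index_mat_adjoint(1)[OF c] index_mat_adjoint(2)[OF c ij]
    have "mat_adjoint X \<in> pattern_of (mat_adjoint X)"
      using a by (simp add: pattern_of_eq mats_with_support_def)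
    thus ?thesis using a ij unfolding pattern_of_eq[OF a(1)] by (auto simp: mats_with_support_def)
  qed
  show ?thesis unfolding pattern_star_def[of P] using X
    by (auto simp: pattern_star_def pattern_adjoint_def)
qed

lemma pattern_adjoint_nonempty:
  assumes "P \<in> patterns p q"
  shows "pattern_adjoint P \<noteq> ({} :: 'a::conjugatable_field mat set)"
proof -
  obtain X where "X \<in> P" using patterns_nonempty[OF assms] by blast
  hence "X \<in> carrier_mat p q" by (rule patterns_memD(1)[OF assms])
  hence "mat_adjoint X \<in> carrier_mat q p" by (rule index_mat_adjoint(1))
  hence "mat_adjoint X \<in> pattern_of (mat_adjoint X)"
    by (simp add: pattern_of_eq mats_with_support_def)
  thus ?thesis using \<open>X \<in> P\<close> by (auto simp: pattern_adjoint_def)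
qed

lemma pattern_star_append_adjoint:
  assumes A: "A \<in> patterns n n" and C: "C \<in> patterns m n"
    and ij: "i < n" "j < n + m"
  shows "pattern_star (pattern_append (pattern_adjoint A) (pattern_adjoint C)) i j \<longleftrightarrow>
    (if j < n then pattern_star A j i else pattern_star C (j - n) i)"
proof -
  have entry: "(\<exists>Z\<in>pattern_of (append_cols X Y). Z $$ (i, j) \<noteq> 0) \<longleftrightarrow>
      (if j < n then X $$ (i, j) \<noteq> 0 else Y $$ (i, j - n) \<noteq> 0)"
    if "X \<in> pattern_adjoint A" "Y \<in> pattern_adjoint C" for X Y
  proof -
    have c: "X \<in> carrier_mat n n" "Y \<in> carrier_mat n m"
      using pattern_adjoint_mem[OF A] pattern_adjoint_mem[OF C] that by auto
    hence ac: "append_cols X Y \<in> carrier_mat n (n + m)" by (simp add: append_cols_def)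
    have "append_cols X Y \<in> pattern_of (append_cols X Y)"
      using ac by (simp add: pattern_of_eq mats_with_support_def)
    moreover have "append_cols X Y $$ (i, j) = (if j < n then X $$ (i, j) else Y $$ (i, j - n))"
      using c ij by (simp add: append_cols_def)
    ultimately show ?thesis
      using ij unfolding pattern_of_eq[OF ac] by (auto simp: mats_with_support_def split: if_splits)
  qed
  have "pattern_star (pattern_append (pattern_adjoint A) (pattern_adjoint C)) i j \<longleftrightarrow>
      (\<exists>X\<in>pattern_adjoint A. \<exists>Y\<in>pattern_adjoint C. \<exists>Z\<in>pattern_of (append_cols X Y). Z $$ (i, j) \<noteq> 0)"
    by (auto simp: pattern_star_def pattern_append_def)
  also have "\<dots> \<longleftrightarrow> (\<exists>X\<in>pattern_adjoint A. \<exists>Y\<in>pattern_adjoint C.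
      if j < n then X $$ (i, j) \<noteq> 0 else Y $$ (i, j - n) \<noteq> 0)"
    using entry by blast
  also have "\<dots> \<longleftrightarrow> (if j < n then pattern_star (pattern_adjoint A) i j else pattern_star (pattern_adjoint C) i (j - n))"
    using pattern_adjoint_nonempty[OF A] pattern_adjoint_nonempty[OF C]
    by (auto simp: pattern_star_def)
  also have "\<dots> \<longleftrightarrow> (if j < n then pattern_star A j i else pattern_star C (j - n) i)"
    using pattern_star_adjoint[OF A] pattern_star_adjoint[OF C] ij by auto
  finally show ?thesis .
qed

text \<open>The graph condition with vertices as zero-based indices: a vertex outside \<open>V\<close> is either a row of the
  state matrix that does not belong to \<open>V\<close>, or a row of the output matrix.\<close>
definition unique_star_condition ::
  "nat \<Rightarrow> nat \<Rightarrow> (nat \<Rightarrow> nat \<Rightarrow> bool) \<Rightarrow> (nat \<Rightarrow> nat \<Rightarrow> bool) \<Rightarrow> bool" where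
  "unique_star_condition n m sA sC \<longleftrightarrow>
     (\<forall>V. V \<noteq> {} \<and> V \<subseteq> {..<n} \<longrightarrow>
        (\<exists>v<n. v \<notin> V \<and> (\<exists>!w. w \<in> V \<and> sA v w)) \<or> (\<exists>j<m. \<exists>!w. w \<in> V \<and> sC j w))"

text \<open>A row index outside \<open>V\<close> has its diagonal position outside the columns \<open>V\<close>.\<close>
lemma unique_star_condition_diagonal:
  "unique_star_condition n m (\<lambda>i j. i = j \<or> sA i j) sC \<longleftrightarrow> unique_star_condition n m sA sC"
proof -
  have "(\<exists>v<n. v \<notin> V \<and> (\<exists>!w. w \<in> V \<and> (v = w \<or> sA v w))) \<longleftrightarrow> (\<exists>v<n. v \<notin> V \<and> (\<exists>!w. w \<in> V \<and> sA v w))"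
    for V :: "nat set"
  proof -
    have "w \<in> V \<and> (v = w \<or> sA v w) \<longleftrightarrow> w \<in> V \<and> sA v w" if "v \<notin> V" for v w using that by auto
    thus ?thesis by (simp cong: conj_cong)
  qed
  thus ?thesis unfolding unique_star_condition_def by simp
qed

text \<open>Adjoining reverses the roles of rows and columns, so an edge from \<open>v\<close> to \<open>w\<close> is a star in row \<open>v\<close> and
  column \<open>w\<close> of the matrix obtained by stacking the state pattern on the output pattern.\<close>
lemma unique_successor_iff_unique_star:
  assumes A: "A \<in> patterns n n" and C: "C \<in> patterns m n"
  shows "unique_successor_condition n (pattern_graph n m A C) \<longleftrightarrow>
    unique_star_condition n m (pattern_star A) (pattern_star C)"
proof -
  let ?G = "pattern_graph n m A C"
  have arcA: "(Suc v, Suc w) \<in> parcs ?G \<longleftrightarrow> pattern_star A v w" if "v < n" "w < n" for v w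
    using that pattern_star_append_adjoint[OF A C, of w v] by (auto simp: pattern_graph_def)
  have arcC: "(Suc (n + j), Suc w) \<in> parcs ?G \<longleftrightarrow> pattern_star C j w" if "j < m" "w < n" for j w
    using that pattern_star_append_adjoint[OF A C, of w "n + j"] by (auto simp: pattern_graph_def)
  have ex1_Suc: "(\<exists>!w. w \<in> Suc ` U \<and> P w) \<longleftrightarrow> (\<exists>!w. w \<in> U \<and> P (Suc w))" for U P
  proof
    assume "\<exists>!w. w \<in> Suc ` U \<and> P w"
    then obtain w where w: "w \<in> Suc ` U" "P w" and uniq: "\<And>w'. w' \<in> Suc ` U \<Longrightarrow> P w' \<Longrightarrow> w' = w"
      by blast
    then obtain u where "u \<in> U" "w = Suc u" by blast
    show "\<exists>!w. w \<in> U \<and> P (Suc w)"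
    proof (rule ex1I[of _ u])
      fix w' assume "w' \<in> U \<and> P (Suc w')"
      hence "Suc w' = w" by (intro uniq) auto
      thus "w' = u" using \<open>w = Suc u\<close> by simp
    qed (use w \<open>u \<in> U\<close> \<open>w = Suc u\<close> in simp)
  next
    assume "\<exists>!w. w \<in> U \<and> P (Suc w)"
    then obtain u where u: "u \<in> U" "P (Suc u)" and uniq: "\<And>w'. w' \<in> U \<Longrightarrow> P (Suc w') \<Longrightarrow> w' = u"
      by blast
    show "\<exists>!w. w \<in> Suc ` U \<and> P w"
    proof (rule ex1I[of _ "Suc u"])
      fix w' assume "w' \<in> Suc ` U \<and> P w'"
      then obtain u' where "u' \<in> U" "w' = Suc u'" "P (Suc u')" by auto
      with uniq[of u'] show "w' = Suc u" by simp
    qed (use u in simp)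
  qed
  have verts: "(\<exists>v\<in>pverts ?G - Suc ` U. Q v) \<longleftrightarrow>
      (\<exists>v<n. v \<notin> U \<and> Q (Suc v)) \<or> (\<exists>j<m. Q (Suc (n + j)))" if U: "U \<subseteq> {..<n}" for U Q
  proof
    assume "\<exists>v\<in>pverts ?G - Suc ` U. Q v"
    then obtain v where v: "1 \<le> v" "v \<le> n + m" "v \<notin> Suc ` U" "Q v" by (auto simp: pattern_graph_def)
    then obtain u where u: "v = Suc u" by (cases v) auto
    show "(\<exists>v<n. v \<notin> U \<and> Q (Suc v)) \<or> (\<exists>j<m. Q (Suc (n + j)))"
    proof (cases "u < n")
      case True thus ?thesis using v u by blast
    next
      case False
      hence "u - n < m" "Q (Suc (n + (u - n)))" using v u by auto
      thus ?thesis by blast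
    qed
  next
    assume "(\<exists>v<n. v \<notin> U \<and> Q (Suc v)) \<or> (\<exists>j<m. Q (Suc (n + j)))"
    thus "\<exists>v\<in>pverts ?G - Suc ` U. Q v"
    proof (elim disjE exE conjE)
      fix v assume "v < n" "v \<notin> U" "Q (Suc v)"
      thus ?thesis by (intro bexI[of _ "Suc v"]) (auto simp: pattern_graph_def)
    next
      fix j assume "j < m" "Q (Suc (n + j))"
      thus ?thesis using U by (intro bexI[of _ "Suc (n + j)"]) (auto simp: pattern_graph_def)
    qed
  qed
  have "unique_successor_condition n ?G \<longleftrightarrow>
      (\<forall>U. U \<noteq> {} \<and> U \<subseteq> {..<n} \<longrightarrow>
        (\<exists>v \<in> pverts ?G - Suc ` U. \<exists>!w. w \<in> Suc ` U \<and> (v, w) \<in> parcs ?G))"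
  proof -
    have sets: "(\<forall>V. V \<noteq> {} \<and> V \<subseteq> {1..n} \<longrightarrow> Q V) \<longleftrightarrow> (\<forall>U. U \<noteq> {} \<and> U \<subseteq> {..<n} \<longrightarrow> Q (Suc ` U))"
      for Q :: "nat set \<Rightarrow> bool"
    proof (intro iffI allI impI)
      fix U :: "nat set"
      assume Q: "\<forall>V. V \<noteq> {} \<and> V \<subseteq> {1..n} \<longrightarrow> Q V" and U: "U \<noteq> {} \<and> U \<subseteq> {..<n}"
      show "Q (Suc ` U)" by (rule Q[rule_format]) (use U in auto)
    next
      fix V :: "nat set"
      assume Q: "\<forall>U. U \<noteq> {} \<and> U \<subseteq> {..<n} \<longrightarrow> Q (Suc ` U)" and V: "V \<noteq> {} \<and> V \<subseteq> {1..n}"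
      have "Suc ` (\<lambda>v. v - 1) ` V = (\<lambda>v. v) ` V"
        unfolding image_image by (rule image_cong) (use V in auto)
      moreover have "(\<lambda>v. v - 1) ` V \<noteq> {} \<and> (\<lambda>v. v - 1) ` V \<subseteq> {..<n}"
      proof -
        have "v - 1 < n" if "v \<in> V" for v
        proof -
          have "v \<in> {1..n}" using V that by blast
          thus ?thesis by auto
        qed
        thus ?thesis using V by blast
      qed
      ultimately show "Q V" using spec[OF Q, of "(\<lambda>v. v - 1) ` V"] by simp
    qed
    show ?thesis unfolding unique_successor_condition_def by (rule sets)
  qed
  also have "\<dots> \<longleftrightarrow> unique_star_condition n m (pattern_star A) (pattern_star C)"
    unfolding unique_star_condition_def
  proof (intro all_cong1 imp_cong refl, elim conjE)
    fix U assume U: "U \<subseteq> {..<n}"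
    have eqA: "(\<exists>!w. w \<in> U \<and> (Suc v, Suc w) \<in> parcs ?G) \<longleftrightarrow> (\<exists>!w. w \<in> U \<and> pattern_star A v w)"
      if "v < n" for v using arcA[OF that] U by (intro arg_cong[where f = Ex1] ext) auto
    have eqC: "(\<exists>!w. w \<in> U \<and> (Suc (n + j), Suc w) \<in> parcs ?G) \<longleftrightarrow> (\<exists>!w. w \<in> U \<and> pattern_star C j w)"
      if "j < m" for j using arcC[OF that] U by (intro arg_cong[where f = Ex1] ext) auto
    show "(\<exists>v \<in> pverts ?G - Suc ` U. \<exists>!w. w \<in> Suc ` U \<and> (v, w) \<in> parcs ?G) \<longleftrightarrow>
        (\<exists>v<n. v \<notin> U \<and> (\<exists>!w. w \<in> U \<and> pattern_star A v w)) \<or> (\<exists>j<m. \<exists>!w. w \<in> U \<and> pattern_star C j w)"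
      unfolding verts[OF U] ex1_Suc by (simp add: eqA eqC cong: conj_cong)
  qed
  finally show ?thesis .
qed

section \<open>The graph condition forces observability\<close>

lemma index_mult_mat_vec_sum:
  assumes "M \<in> carrier_mat p q" "v \<in> carrier_vec q" "i < p"
  shows "vec_index (M *\<^sub>v v) i = (\<Sum>j<q. M $$ (i, j) * vec_index v j)"
  using assms by (auto simp: scalar_prod_def atLeast0LessThan intro!: sum.cong)

lemma is_ct_system_linear_ode:
  assumes "is_ct_system n r m S"
  shows "linear_ode n (\<lambda>i j t. coeff_A S t $$ (i, j)) a b"
  using assms by unfold_locales (auto simp: is_ct_system_def locally_integrable_mat_def)

lemma is_solution_subinterval:
  assumes "is_solution n S u a b x" "a \<le> a'" "b' \<le> b"
  shows "is_solution n S u a' b' x"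
  using assms(1) unfolding is_solution_def
proof (elim conjE, intro conjI)
  assume x: "\<forall>t\<in>{a..b}. x t \<in> carrier_vec n"
    and ac: "\<forall>i<n. abs_continuous a b (\<lambda>t. vec_index (x t) i)"
    and der: "AE t in lebesgue. t \<in> {a..b} \<longrightarrow> (\<forall>i<n. ((\<lambda>s. vec_index (x s) i) has_vector_derivative
           vec_index (coeff_A S t *\<^sub>v x t + coeff_B S t *\<^sub>v u t) i) (at t))"
  show "\<forall>t\<in>{a'..b'}. x t \<in> carrier_vec n" using x assms(2,3) by auto
  show "\<forall>i<n. abs_continuous a' b' (\<lambda>t. vec_index (x t) i)"
    using ac abs_continuous_subinterval[OF _ assms(2,3)] by blast
  show "AE t in lebesgue. t \<in> {a'..b'} \<longrightarrow> (\<forall>i<n. ((\<lambda>s. vec_index (x s) i) has_vector_derivative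
           vec_index (coeff_A S t *\<^sub>v x t + coeff_B S t *\<^sub>v u t) i) (at t))"
    using der by eventually_elim (use assms(2,3) in auto)
qed

text \<open>The input cancels, so differences of solutions obey the homogeneous equation.\<close>
lemma solution_diff_derivative:
  assumes S: "is_ct_system n r m S"
    and x: "is_solution n S u a b x" and y: "is_solution n S u a b y"
  shows "AE t in lebesgue. t \<in> {a..b} \<longrightarrow>
    (\<forall>i<n. ((\<lambda>s. vec_index (x s) i - vec_index (y s) i) has_vector_derivative
       (\<Sum>j<n. coeff_A S t $$ (i, j) * (vec_index (x t) j - vec_index (y t) j))) (at t))"
proof -
  have dx: "AE t in lebesgue. t \<in> {a..b} \<longrightarrow> (\<forall>i<n. ((\<lambda>s. vec_index (x s) i) has_vector_derivative
           vec_index (coeff_A S t *\<^sub>v x t + coeff_B S t *\<^sub>v u t) i) (at t))"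
    and dy: "AE t in lebesgue. t \<in> {a..b} \<longrightarrow> (\<forall>i<n. ((\<lambda>s. vec_index (y s) i) has_vector_derivative
           vec_index (coeff_A S t *\<^sub>v y t + coeff_B S t *\<^sub>v u t) i) (at t))"
    using x y by (auto simp: is_solution_def)
  show ?thesis using dx dy
  proof eventually_elim
    case (elim t)
    show ?case
    proof (intro impI allI)
      fix i assume t: "t \<in> {a..b}" and i: "i < n"
      have c: "coeff_A S t \<in> carrier_mat n n" "coeff_B S t \<in> carrier_mat n r"
        "x t \<in> carrier_vec n" "y t \<in> carrier_vec n"
        using S x y t by (auto simp: is_ct_system_def is_solution_def)
      have "vec_index (coeff_A S t *\<^sub>v x t + coeff_B S t *\<^sub>v u t) i
          - vec_index (coeff_A S t *\<^sub>v y t + coeff_B S t *\<^sub>v u t) i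
          = vec_index (coeff_A S t *\<^sub>v x t) i - vec_index (coeff_A S t *\<^sub>v y t) i"
        using c i by simp
      also have "\<dots> = (\<Sum>j<n. coeff_A S t $$ (i, j) * (vec_index (x t) j - vec_index (y t) j))"
        using c i by (simp only: index_mult_mat_vec_sum right_diff_distrib sum_subtractf)
      finally show "((\<lambda>s. vec_index (x s) i - vec_index (y s) i) has_vector_derivative
           (\<Sum>j<n. coeff_A S t $$ (i, j) * (vec_index (x t) j - vec_index (y t) j))) (at t)"
        using has_vector_derivative_diff[OF elim(1)[rule_format, OF t i] elim(2)[rule_format, OF t i]] by simp
    qed
  qed
qed

lemma solution_component_continuous_on:
  assumes "is_solution n S u a b x" "i < n"
  shows "continuous_on {a..b} (\<lambda>t. vec_index (x t) i)"
  using assms by (intro abs_continuous_imp_continuous_on) (simp add: is_solution_def)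

lemma solution_unique:
  assumes S: "is_ct_system n r m S"
    and x: "is_solution n S u a b x" and y: "is_solution n S u a b y"
    and init: "x a = y a" and t: "t \<in> {a..b}"
  shows "x t = y t"
proof -
  interpret linear_ode n "\<lambda>i j t. coeff_A S t $$ (i, j)" a b
    by (rule is_ct_system_linear_ode[OF S])
  define z where "z i t = vec_index (x t) i - vec_index (y t) i" for i t
  have ac: "abs_continuous a b (z i)" if "i < n" for i
    unfolding z_def[abs_def] using x y that by (intro abs_continuous_diff) (auto simp: is_solution_def)
  have cont: "continuous_on {a..b} (z i)" if "i < n" for i
    by (rule abs_continuous_imp_continuous_on[OF ac[OF that]])
  have "z i t = integral {a..t} (rhs z i)" if i: "i < n" and t: "t \<in> {a..b}" for i t
  proof -
    have "AE t in lebesgue. t \<in> {a..b} \<longrightarrow> (z i has_vector_derivative rhs z i t) (at t)"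
      using solution_diff_derivative[OF S x y]
      by eventually_elim (use i in \<open>auto simp: z_def[abs_def] rhs_def\<close>)
    from abs_continuous_eq_integral[OF ac[OF i] rhs_absolutely_integrable[OF i cont] this t]
    show ?thesis using init by (simp add: z_def)
  qed
  hence "z i t = 0" if "i < n" for i
    using integral_equation_unique[where z = z, OF cont _ that t] by blast
  moreover have "x t \<in> carrier_vec n" "y t \<in> carrier_vec n"
    using x y t by (auto simp: is_solution_def)
  ultimately show ?thesis by (intro eq_vecI) (auto simp: z_def)
qed

text \<open>The description defining \<open>phi\<close> denotes as soon as one solution is known, by uniqueness.\<close>
lemma phi_eq_solution:
  assumes S: "is_ct_system n r m S" and x: "is_solution n S u t0 t x" and t: "t0 \<le> t"
  shows "phi n S t t0 (x t0) u = x t"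
  unfolding phi_def
proof (rule the_equality)
  show "\<exists>y. is_solution n S u t0 t y \<and> y t0 = x t0 \<and> y t = x t" using x by blast
  show "z = x t" if "\<exists>y. is_solution n S u t0 t y \<and> y t0 = x t0 \<and> y t = z" for z
    using that solution_unique[OF S _ x] t by auto
qed

text \<open>Needed because \<open>phi\<close> carries no information unless a solution exists. The zero input suffices: it
  already separates any two distinct initial states when the graph condition holds.\<close>
lemma unforced_solution_exists:
  assumes S: "is_ct_system n r m S" and x0: "x0 \<in> carrier_vec n" and ab: "a \<le> b"
  shows "\<exists>x. is_solution n S (\<lambda>_. 0\<^sub>v r) a b x \<and> x a = x0"
proof -
  interpret linear_ode n "\<lambda>i j t. coeff_A S t $$ (i, j)" a b
    by (rule is_ct_system_linear_ode[OF S])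
  obtain y where cont: "\<And>i. i < n \<Longrightarrow> continuous_on {a..b} (y i)"
    and eq: "\<And>i t. \<lbrakk>i < n; t \<in> {a..b}\<rbrakk> \<Longrightarrow> y i t = vec_index x0 i + integral {a..t} (rhs y i)"
    using integral_equation_exists by metis
  define x where "x t = vec n (\<lambda>i. vec_index x0 i + integral {a..t} (rhs y i))" for t
  have xi: "(\<lambda>t. vec_index (x t) i) = (\<lambda>t. vec_index x0 i + integral {a..t} (rhs y i))" if "i < n" for i
    using that by (simp add: x_def)
  note int = rhs_absolutely_integrable[where x = y, OF _ cont]
  have "is_solution n S (\<lambda>_. 0\<^sub>v r) a b x"
    unfolding is_solution_def
  proof (intro conjI allI impI ballI)
    show "x t \<in> carrier_vec n" for t by (simp add: x_def)
    show "abs_continuous a b (\<lambda>t. vec_index (x t) i)" if "i < n" for i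
      unfolding xi[OF that]
      by (rule abs_continuous_compose_lipschitz[OF abs_continuous_indefinite_integral[OF int[OF that]],
            where B = 1]) simp_all
    have "AE t in lebesgue. \<forall>i\<in>{..<n}. t \<in> {a..b} \<longrightarrow>
        ((\<lambda>s. integral {a..s} (rhs y i)) has_vector_derivative rhs y i t) (at t)"
      by (intro AE_finite_allI indefinite_integral_has_vector_derivative_AE)
         (use int in \<open>auto simp: absolutely_integrable_on_def\<close>)
    thus "AE t in lebesgue. t \<in> {a..b} \<longrightarrow> (\<forall>i<n. ((\<lambda>s. vec_index (x s) i) has_vector_derivative
           vec_index (coeff_A S t *\<^sub>v x t + coeff_B S t *\<^sub>v 0\<^sub>v r) i) (at t))"
    proof eventually_elim
      case (elim t)
      show ?case
      proof (intro impI allI)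
        fix i assume t: "t \<in> {a..b}" and i: "i < n"
        have c: "coeff_A S t \<in> carrier_mat n n" "coeff_B S t \<in> carrier_mat n r" "x t \<in> carrier_vec n"
          using S by (auto simp: is_ct_system_def x_def)
        have "vec_index (coeff_A S t *\<^sub>v x t + coeff_B S t *\<^sub>v 0\<^sub>v r) i = vec_index (coeff_A S t *\<^sub>v x t) i"
          using c i by (simp add: scalar_prod_def)
        also have "\<dots> = (\<Sum>j<n. coeff_A S t $$ (i, j) * vec_index (x t) j)"
          by (rule index_mult_mat_vec_sum[OF c(1,3) i])
        also have "\<dots> = rhs y i t"
          unfolding rhs_def using eq[OF _ t] by (intro sum.cong) (auto simp: x_def)
        finally show "((\<lambda>s. vec_index (x s) i) has_vector_derivative
           vec_index (coeff_A S t *\<^sub>v x t + coeff_B S t *\<^sub>v 0\<^sub>v r) i) (at t)"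
          using elim t i by (auto simp: xi[OF i] intro!: derivative_eq_intros)
      qed
    qed
  qed
  moreover have "x a = x0" using x0 by (intro eq_vecI) (auto simp: x_def)
  ultimately show ?thesis by blast
qed

text \<open>The points of the open interval where \<open>f\<close> does not vanish form an open null set, which is empty.\<close>
lemma AE_zero_continuous_imp_zero:
  fixes f :: "real \<Rightarrow> 'b::real_normed_vector"
  assumes f: "continuous_on {a..b} f" and ab: "a < b"
    and ae: "AE t in lebesgue. t \<in> {a<..<b} \<longrightarrow> f t = 0" and t: "t \<in> {a..b}"
  shows "f t = 0"
proof -
  obtain N where N: "\<And>x. x \<in> space lebesgue - N \<Longrightarrow> x \<in> {a<..<b} \<longrightarrow> f x = 0" and "N \<in> null_sets lebesgue"
    using AE_E3[OF ae] by blast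
  hence "negligible N" by (simp add: negligible_iff_null_sets)
  define U where "U = {a<..<b} \<inter> f -` (- {0})"
  have "open U" unfolding U_def
    by (rule continuous_open_preimage[OF continuous_on_subset[OF f]]) auto
  moreover have "negligible U"
    by (rule negligible_subset[OF \<open>negligible N\<close>]) (use N in \<open>auto simp: U_def\<close>)
  ultimately have "U = {}" using open_not_negligible by blast
  hence "\<And>x. x \<in> {a<..<b} \<Longrightarrow> f x = 0" by (auto simp: U_def)
  moreover have "closure {a<..<b} = {a..b}" using ab by (rule closure_greaterThanLessThan)
  ultimately show ?thesis
    using continuous_constant_on_closure[of "{a<..<b}" f 0 t] f t by simp
qed

text \<open>The elimination argument: a row with a single star among the components that do not vanish
  identically forces one of them to vanish after all.\<close>
lemma unobserved_trajectory_vanishes: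
  fixes z :: "nat \<Rightarrow> real \<Rightarrow> 'a::{real_normed_field, euclidean_space}"
  assumes cond: "unique_star_condition n m sA sC" and ab: "a < b"
    and cont: "\<And>i. i < n \<Longrightarrow> continuous_on {a..b} (z i)"
    and pat: "AE t in lebesgue. A t \<in> mats_with_support n n sA \<and> C t \<in> mats_with_support m n sC"
    and der: "AE t in lebesgue. t \<in> {a..b} \<longrightarrow>
      (\<forall>i<n. (z i has_vector_derivative (\<Sum>j<n. A t $$ (i, j) * z j t)) (at t))"
    and out: "AE t in lebesgue. t \<in> {a..b} \<longrightarrow> (\<forall>k<m. (\<Sum>j<n. C t $$ (k, j) * z j t) = 0)"
    and i: "i < n" and t: "t \<in> {a..b}"
  shows "z i t = 0"
proof (rule ccontr)
  assume nz: "z i t \<noteq> 0"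
  define V where "V = {i. i < n \<and> (\<exists>t\<in>{a..b}. z i t \<noteq> 0)}"
  have zero: "z j s = 0" if "j < n" "j \<notin> V" "s \<in> {a..b}" for j s using that by (auto simp: V_def)
  have single: "(\<Sum>j<n. c j * z j s) = c w * z w s"
    if w: "w \<in> V" and others: "\<And>j. \<lbrakk>j \<in> V; j \<noteq> w\<rbrakk> \<Longrightarrow> c j = 0" and s: "s \<in> {a..b}" for c w s
  proof -
    have "(\<Sum>j<n. c j * z j s) = (\<Sum>j<n. if j = w then c j * z j s else 0)"
      using zero[OF _ _ s] others by (intro sum.cong refl) auto
    also have "\<dots> = c w * z w s" using w by (simp add: V_def)
    finally show ?thesis .
  qed
  have "i \<in> V" using nz i t unfolding V_def by blast
  hence "V \<noteq> {}" "V \<subseteq> {..<n}" by (auto simp: V_def)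
  with cond consider v where "v < n" "v \<notin> V" "\<exists>!w. w \<in> V \<and> sA v w"
    | k where "k < m" "\<exists>!w. w \<in> V \<and> sC k w"
    unfolding unique_star_condition_def by metis
  hence "\<exists>w\<in>V. AE s in lebesgue. s \<in> {a<..<b} \<longrightarrow> z w s = 0"
  proof cases
    case (1 v)
    then obtain w where w: "w \<in> V" "sA v w" and uniq: "\<And>j. \<lbrakk>j \<in> V; sA v j\<rbrakk> \<Longrightarrow> j = w" by blast
    have "AE s in lebesgue. s \<in> {a<..<b} \<longrightarrow> z w s = 0"
      using pat der
    proof eventually_elim
      case (elim s)
      show ?case
      proof
        assume s: "s \<in> {a<..<b}"
        hence s': "s \<in> {a..b}" by auto
        \<comment> \<open>Component \<open>v\<close> vanishes identically, hence so does its derivative at interior points.\<close>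
        have "((\<lambda>_. 0) has_vector_derivative 0) (at s)" by simp
        hence "(z v has_vector_derivative 0) (at s)"
          by (rule has_vector_derivative_transform_within_open[where S = "{a<..<b}"])
             (use s zero[OF 1(1,2)] in auto)
        moreover have "(z v has_vector_derivative (\<Sum>j<n. A s $$ (v, j) * z j s)) (at s)"
          using elim(2) s' 1 by blast
        ultimately have "(\<Sum>j<n. A s $$ (v, j) * z j s) = 0"
          by (rule vector_derivative_unique_at[symmetric])
        moreover have "(\<Sum>j<n. A s $$ (v, j) * z j s) = A s $$ (v, w) * z w s"
        proof (rule single[OF w(1) _ s'])
          fix j assume "j \<in> V" "j \<noteq> w"
          thus "A s $$ (v, j) = 0"
            using mats_with_supportD(2)[OF conjunct1[OF elim(1)] 1(1), of j] uniq[of j] by (auto simp: V_def)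
        qed
        moreover have "A s $$ (v, w) \<noteq> 0"
          using mats_with_supportD(2)[OF conjunct1[OF elim(1)] 1(1), of w] w by (auto simp: V_def)
        ultimately show "z w s = 0" by simp
      qed
    qed
    thus ?thesis using w by blast
  next
    case (2 k)
    then obtain w where w: "w \<in> V" "sC k w" and uniq: "\<And>j. \<lbrakk>j \<in> V; sC k j\<rbrakk> \<Longrightarrow> j = w" by blast
    have "AE s in lebesgue. s \<in> {a<..<b} \<longrightarrow> z w s = 0"
      using pat out
    proof eventually_elim
      case (elim s)
      show ?case
      proof
        assume s: "s \<in> {a<..<b}"
        hence s': "s \<in> {a..b}" by auto
        have "(\<Sum>j<n. C s $$ (k, j) * z j s) = 0" using elim(2) s' 2 by blast
        moreover have "(\<Sum>j<n. C s $$ (k, j) * z j s) = C s $$ (k, w) * z w s"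
        proof (rule single[OF w(1) _ s'])
          fix j assume "j \<in> V" "j \<noteq> w"
          thus "C s $$ (k, j) = 0"
            using mats_with_supportD(2)[OF conjunct2[OF elim(1)] 2(1), of j] uniq[of j] by (auto simp: V_def)
        qed
        moreover have "C s $$ (k, w) \<noteq> 0"
          using mats_with_supportD(2)[OF conjunct2[OF elim(1)] 2(1), of w] w by (auto simp: V_def)
        ultimately show "z w s = 0" by simp
      qed
    qed
    thus ?thesis using w by blast
  qed
  then obtain w where "w \<in> V" and ae: "AE s in lebesgue. s \<in> {a<..<b} \<longrightarrow> z w s = 0" by blast
  hence "w < n" by (simp add: V_def)
  hence "\<And>s. s \<in> {a..b} \<Longrightarrow> z w s = 0" using AE_zero_continuous_imp_zero[OF cont ab ae] by blast
  with \<open>w \<in> V\<close> show False by (auto simp: V_def)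
qed

lemma zero_input_signal: "input_signal r \<tau>0 \<tau>1 (\<lambda>_. 0\<^sub>v r)"
  unfolding input_signal_def by (auto intro!: exI[of _ 0])

theorem unique_star_imp_observable_on:
  assumes cond: "unique_star_condition n m sA sC" and t01: "t0 < t1"
    and S: "is_ct_system n r m S"
    and pat: "of_output_pattern n m (mats_with_support n n sA) (mats_with_support m n sC) S"
  shows "observable_on n r S t0 t1"
  unfolding observable_on_def
proof (intro allI impI)
  fix x0 x1 assume ind: "indistinguishable n r S t0 t1 x0 x1"
  hence c: "x0 \<in> carrier_vec n" "x1 \<in> carrier_vec n" by (auto simp: indistinguishable_def)
  let ?u = "\<lambda>_. 0\<^sub>v r"
  obtain X0 where X0: "is_solution n S ?u t0 t1 X0" "X0 t0 = x0"
    using unforced_solution_exists[OF S c(1), of t0 t1] t01 by auto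
  obtain X1 where X1: "is_solution n S ?u t0 t1 X1" "X1 t0 = x1"
    using unforced_solution_exists[OF S c(2), of t0 t1] t01 by auto
  have phi: "phi n S t t0 x0 ?u = X0 t" "phi n S t t0 x1 ?u = X1 t" if "t \<in> {t0..t1}" for t
    using phi_eq_solution[OF S is_solution_subinterval[OF X0(1)], of t0 t]
      phi_eq_solution[OF S is_solution_subinterval[OF X1(1)], of t0 t] X0(2) X1(2) that by auto
  define z where "z i t = vec_index (X0 t) i - vec_index (X1 t) i" for i t
  have "AE t in lebesgue. t \<in> {t0..t1} \<longrightarrow>
      coeff_C S t *\<^sub>v phi n S t t0 x0 ?u = coeff_C S t *\<^sub>v phi n S t t0 x1 ?u"
    using ind zero_input_signal unfolding indistinguishable_def by blast
  hence out: "AE t in lebesgue. t \<in> {t0..t1} \<longrightarrow> (\<forall>k<m. (\<Sum>j<n. coeff_C S t $$ (k, j) * z j t) = 0)"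
  proof eventually_elim
    case (elim t)
    show ?case
    proof (intro impI allI)
      fix k assume t: "t \<in> {t0..t1}" and k: "k < m"
      have cc: "coeff_C S t \<in> carrier_mat m n" "X0 t \<in> carrier_vec n" "X1 t \<in> carrier_vec n"
        using S X0 X1 t by (auto simp: is_ct_system_def is_solution_def)
      have "coeff_C S t *\<^sub>v X0 t = coeff_C S t *\<^sub>v X1 t" using elim t phi[OF t] by simp
      hence "(\<Sum>j<n. coeff_C S t $$ (k, j) * vec_index (X0 t) j) = (\<Sum>j<n. coeff_C S t $$ (k, j) * vec_index (X1 t) j)"
        using index_mult_mat_vec_sum[OF cc(1,2) k] index_mult_mat_vec_sum[OF cc(1,3) k] by simp
      thus "(\<Sum>j<n. coeff_C S t $$ (k, j) * z j t) = 0"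
        by (simp add: z_def right_diff_distrib sum_subtractf)
    qed
  qed
  have der: "AE t in lebesgue. t \<in> {t0..t1} \<longrightarrow>
      (\<forall>i<n. (z i has_vector_derivative (\<Sum>j<n. coeff_A S t $$ (i, j) * z j t)) (at t))"
    using solution_diff_derivative[OF S X0(1) X1(1)] by (simp add: z_def[abs_def])
  have cont: "continuous_on {t0..t1} (z i)" if "i < n" for i
    unfolding z_def[abs_def]
    by (intro continuous_on_diff solution_component_continuous_on[OF X0(1) that] solution_component_continuous_on[OF X1(1) that])
  have ae: "AE t in lebesgue. coeff_A S t \<in> mats_with_support n n sA \<and> coeff_C S t \<in> mats_with_support m n sC"
    using pat by (simp add: of_output_pattern_def)
  have "z i t0 = 0" if "i < n" for i
    by (rule unobserved_trajectory_vanishes[OF cond t01 cont ae der out that]) (use t01 in auto)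
  thus "x0 = x1" using c X0(2) X1(2) by (intro eq_vecI) (auto simp: z_def)
qed

section \<open>Unobservable systems when the graph condition fails\<close>

text \<open>Makes explicitly given smooth trajectories qualify as solutions.\<close>
lemma abs_continuous_of_continuous_derivative:
  fixes f f' :: "real \<Rightarrow> 'b::euclidean_space"
  assumes der: "\<And>t. (f has_vector_derivative f' t) (at t)" and cont: "continuous_on UNIV f'"
  shows "abs_continuous a b f"
proof (rule abs_continuous_compose_lipschitz[where g = "\<lambda>t. integral {a..t} f'" and B = 1])
  have "f' absolutely_integrable_on {a..b}"
    by (intro absolutely_integrable_continuous_real continuous_on_subset[OF cont]) auto
  thus "abs_continuous a b (\<lambda>t. integral {a..t} f')" by (rule abs_continuous_indefinite_integral)
  have "integral {a..t} f' = f t - f a" if "a \<le> t" for t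
    by (rule integral_unique, rule fundamental_theorem_of_calculus[OF that])
       (rule has_vector_derivative_at_within[OF der])
  thus "norm (f t - f s) \<le> 1 * norm (integral {a..t} f' - integral {a..s} f')"
    if "a \<le> s" "s \<le> t" "t \<le> b" for s t using that by simp
qed

text \<open>Inputs are constrained only on the half-open interval, so the right end point, where \<open>B u\<close> may be
  meaningless, has to be discarded as a null set.\<close>
lemma unforced_solution_is_solution:
  assumes S: "is_ct_system n r m S" and B: "\<And>t. coeff_B S t = 0\<^sub>m n r"
    and w: "\<And>t. w t \<in> carrier_vec n"
    and der: "\<And>i t. i < n \<Longrightarrow> ((\<lambda>s. vec_index (w s) i) has_vector_derivative vec_index (coeff_A S t *\<^sub>v w t) i) (at t)"
    and ac: "\<And>i. i < n \<Longrightarrow> abs_continuous a b (\<lambda>t. vec_index (w t) i)"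
    and u: "\<And>t. t \<in> {a..<b} \<Longrightarrow> u t \<in> carrier_vec r"
  shows "is_solution n S u a b w"
  unfolding is_solution_def
proof (intro conjI allI impI ballI w ac)
  have "AE t in lebesgue. t \<noteq> b"
    by (rule AE_I'[of "{b}"]) (auto simp flip: negligible_iff_null_sets)
  thus "AE t in lebesgue. t \<in> {a..b} \<longrightarrow> (\<forall>i<n. ((\<lambda>s. vec_index (w s) i) has_vector_derivative
           vec_index (coeff_A S t *\<^sub>v w t + coeff_B S t *\<^sub>v u t) i) (at t))"
  proof eventually_elim
    case (elim t)
    show ?case
    proof (intro impI allI)
      fix i assume t: "t \<in> {a..b}" and i: "i < n"
      \<comment> \<open>The dimension of \<open>u t\<close> matters: outside the carrier, not even the zero matrix gives a zero product.\<close>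
      have "u t \<in> carrier_vec r" using u elim t by auto
      hence "vec_index (coeff_A S t *\<^sub>v w t + coeff_B S t *\<^sub>v u t) i = vec_index (coeff_A S t *\<^sub>v w t) i"
        using i by (simp add: B scalar_prod_def)
      thus "((\<lambda>s. vec_index (w s) i) has_vector_derivative
           vec_index (coeff_A S t *\<^sub>v w t + coeff_B S t *\<^sub>v u t) i) (at t)"
        using der[OF i] by simp
    qed
  qed
qed

text \<open>With \<open>B = 0\<close> no input influences the state, so a single unobserved trajectory makes its initial state
  indistinguishable from zero.\<close>
lemma unobserved_trajectory_indistinguishable:
  fixes S :: "'a::{real_normed_field, euclidean_space} ct_system"
  assumes S: "is_ct_system n r m S" and B: "\<And>t. coeff_B S t = 0\<^sub>m n r"
    and w: "\<And>t. w t \<in> carrier_vec n"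
    and der: "\<And>i t. i < n \<Longrightarrow> ((\<lambda>s. vec_index (w s) i) has_vector_derivative vec_index (coeff_A S t *\<^sub>v w t) i) (at t)"
    and ac: "\<And>i a b. i < n \<Longrightarrow> abs_continuous a b (\<lambda>t. vec_index (w t) i)"
    and out: "\<And>t. coeff_C S t *\<^sub>v w t = 0\<^sub>v m"
  shows "indistinguishable n r S \<tau>0 \<tau>1 (w \<tau>0) (0\<^sub>v n)"
  unfolding indistinguishable_def
proof (intro conjI allI impI)
  fix u :: "real \<Rightarrow> 'a vec" assume "input_signal r \<tau>0 \<tau>1 u"
  hence u: "u t \<in> carrier_vec r" if "t \<in> {\<tau>0..<\<tau>1}" for t using that by (simp add: input_signal_def)
  have cA: "coeff_A S t \<in> carrier_mat n n" and cC: "coeff_C S t \<in> carrier_mat m n" for t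
    using S by (auto simp: is_ct_system_def)
  have A0: "coeff_A S t *\<^sub>v 0\<^sub>v n = 0\<^sub>v n" and C0: "coeff_C S t *\<^sub>v 0\<^sub>v n = 0\<^sub>v m" for t
    using cA[of t] cC[of t] by (auto simp: scalar_prod_def)
  have "coeff_C S t *\<^sub>v phi n S t \<tau>0 (w \<tau>0) u = coeff_C S t *\<^sub>v phi n S t \<tau>0 (0\<^sub>v n) u"
    if t: "t \<in> {\<tau>0..\<tau>1}" for t
  proof -
    have "is_solution n S u \<tau>0 t w"
      by (rule unforced_solution_is_solution[OF S B w der ac]) (use u t in auto)
    hence "phi n S t \<tau>0 (w \<tau>0) u = w t" by (rule phi_eq_solution[OF S]) (use t in auto)
    moreover have "is_solution n S u \<tau>0 t (\<lambda>_. 0\<^sub>v n)"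
    proof (rule unforced_solution_is_solution[OF S B])
      show "abs_continuous \<tau>0 t (\<lambda>t. vec_index (0\<^sub>v n :: 'a vec) i)" for i
        by (rule abs_continuous_of_continuous_derivative[where f' = "\<lambda>_. 0"]) auto
    qed (use u t A0 in auto)
    from phi_eq_solution[OF S this] have "phi n S t \<tau>0 (0\<^sub>v n) u = 0\<^sub>v n" using t by simp
    ultimately show ?thesis using out C0 by simp
  qed
  thus "AE t in lebesgue. t \<in> {\<tau>0..\<tau>1} \<longrightarrow>
      coeff_C S t *\<^sub>v phi n S t \<tau>0 (w \<tau>0) u = coeff_C S t *\<^sub>v phi n S t \<tau>0 (0\<^sub>v n) u"
    by (intro AE_I2) auto
qed (use w in auto)

text \<open>With at least two available positions in \<open>V\<close>, put \<open>1\<close> at all of them but one, and minus their number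
  at the remaining one; with no available position the sum over \<open>V\<close> is empty of nonzero terms.\<close>
lemma row_with_zero_sum:
  fixes V :: "nat set" and s :: "nat \<Rightarrow> bool"
  assumes V: "finite V" and not_unique: "\<not> (\<exists>!w. w \<in> V \<and> s w)"
  shows "\<exists>c :: nat \<Rightarrow> 'a::field_char_0. (\<forall>w. c w \<noteq> 0 \<longleftrightarrow> s w) \<and> (\<Sum>w\<in>V. c w) = 0"
proof (cases "\<exists>w. w \<in> V \<and> s w")
  case False
  thus ?thesis
    by (intro exI[of _ "\<lambda>w. if s w then 1 else 0"]) (auto intro!: sum.neutral)
next
  case True
  then obtain w0 where w0: "w0 \<in> V" "s w0" by blast
  define T where "T = {w \<in> V. s w} - {w0}"
  have "T \<noteq> {}" using not_unique w0 by (auto simp: T_def)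
  have finT: "finite T" using V by (simp add: T_def)
  define c :: "nat \<Rightarrow> 'a" where "c w = (if w = w0 then - of_nat (card T) else if s w then 1 else 0)" for w
  have "(\<Sum>w\<in>V. c w) = (\<Sum>w\<in>insert w0 T. c w)"
    by (rule sum.mono_neutral_right) (use V w0 in \<open>auto simp: T_def c_def\<close>)
  also have "\<dots> = c w0 + (\<Sum>w\<in>T. c w)"
    by (rule sum.insert[OF finT]) (simp add: T_def)
  also have "(\<Sum>w\<in>T. c w) = (\<Sum>w\<in>T. 1)" by (rule sum.cong) (auto simp: T_def c_def)
  also have "c w0 + \<dots> = 0" by (simp add: c_def)
  finally have "(\<Sum>w\<in>V. c w) = 0" .
  moreover have "c w \<noteq> 0 \<longleftrightarrow> s w" for w
    using w0 \<open>T \<noteq> {}\<close> finT by (auto simp: c_def)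
  ultimately show ?thesis by blast
qed

lemma not_unique_star_imp_balanced_rows:
  assumes "\<not> unique_star_condition n m sA sC"
  shows "\<exists>V. \<exists>(e :: nat \<Rightarrow> nat \<Rightarrow> 'a::field_char_0) (c :: nat \<Rightarrow> nat \<Rightarrow> 'a). V \<noteq> {} \<and> V \<subseteq> {..<n} \<and>
    (\<forall>v. v < n \<and> v \<notin> V \<longrightarrow> (\<forall>w. e v w \<noteq> 0 \<longleftrightarrow> sA v w) \<and> (\<Sum>w\<in>V. e v w) = 0) \<and>
    (\<forall>k. k < m \<longrightarrow> (\<forall>w. c k w \<noteq> 0 \<longleftrightarrow> sC k w) \<and> (\<Sum>w\<in>V. c k w) = 0)"
proof -
  obtain V where V: "V \<noteq> {}" "V \<subseteq> {..<n}"
    and none: "\<not> ((\<exists>v<n. v \<notin> V \<and> (\<exists>!w. w \<in> V \<and> sA v w)) \<or> (\<exists>j<m. \<exists>!w. w \<in> V \<and> sC j w))"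
    using assms unfolding unique_star_condition_def not_all not_imp by (elim exE conjE)
  note none' = none[unfolded de_Morgan_disj not_ex]
  note noneA = conjunct1[OF none'] and noneC = conjunct2[OF none']
  have rowA: "\<not> (\<exists>!w. w \<in> V \<and> sA v w)" if "v < n" "v \<notin> V" for v
    using spec[OF noneA, of v] that by (simp only: simp_thms)
  have rowC: "\<not> (\<exists>!w. w \<in> V \<and> sC k w)" if "k < m" for k
    using spec[OF noneC, of k] that by (simp only: simp_thms)
  have fin: "finite V" using V(2) finite_subset by blast
  have "\<exists>c :: nat \<Rightarrow> 'a. v < n \<and> v \<notin> V \<longrightarrow> (\<forall>w. c w \<noteq> 0 \<longleftrightarrow> sA v w) \<and> (\<Sum>w\<in>V. c w) = 0" for v
  proof (cases "v < n \<and> v \<notin> V")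
    case True
    thus ?thesis using row_with_zero_sum[OF fin rowA, of v] by simp
  next
    case False
    show ?thesis by (intro exI impI) (erule notE[OF False])
  qed
  hence "\<forall>v. \<exists>c :: nat \<Rightarrow> 'a. v < n \<and> v \<notin> V \<longrightarrow> (\<forall>w. c w \<noteq> 0 \<longleftrightarrow> sA v w) \<and> (\<Sum>w\<in>V. c w) = 0"
    by (rule allI)
  from choice[OF this] obtain e :: "nat \<Rightarrow> nat \<Rightarrow> 'a"
    where e: "\<forall>v. v < n \<and> v \<notin> V \<longrightarrow> (\<forall>w. e v w \<noteq> 0 \<longleftrightarrow> sA v w) \<and> (\<Sum>w\<in>V. e v w) = 0" ..
  have "\<exists>c :: nat \<Rightarrow> 'a. k < m \<longrightarrow> (\<forall>w. c w \<noteq> 0 \<longleftrightarrow> sC k w) \<and> (\<Sum>w\<in>V. c w) = 0" for k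
  proof (cases "k < m")
    case True
    thus ?thesis using row_with_zero_sum[OF fin rowC, of k] by simp
  next
    case False
    show ?thesis by (intro exI impI) (erule notE[OF False])
  qed
  hence "\<forall>k. \<exists>c :: nat \<Rightarrow> 'a. k < m \<longrightarrow> (\<forall>w. c w \<noteq> 0 \<longleftrightarrow> sC k w) \<and> (\<Sum>w\<in>V. c w) = 0"
    by (rule allI)
  from choice[OF this] obtain c :: "nat \<Rightarrow> nat \<Rightarrow> 'a"
    where c: "\<forall>k. k < m \<longrightarrow> (\<forall>w. c k w \<noteq> 0 \<longleftrightarrow> sC k w) \<and> (\<Sum>w\<in>V. c k w) = 0" ..
  show ?thesis
    by (rule exI[of _ V], rule exI[of _ e], rule exI[of _ c]) (intro conjI V e c)
qed

text \<open>The rows outside \<open>V\<close> are those of \<open>e\<close>. In the rows of \<open>V\<close> the diagonal entry compensates the ones at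
  the off-diagonal stars in such a way that the entries in the columns \<open>V\<close> sum up to \<open>\<mu>\<close>.\<close>
definition complete_rows ::
  "(nat \<Rightarrow> nat \<Rightarrow> bool) \<Rightarrow> nat set \<Rightarrow> real \<Rightarrow> (nat \<Rightarrow> nat \<Rightarrow> 'a::real_normed_field) \<Rightarrow> nat \<Rightarrow> nat \<Rightarrow> 'a" where
  "complete_rows s V \<mu> e v w =
     (if v \<notin> V then e v w
      else if v = w then of_real (\<mu> - real (card {j \<in> V - {v}. s v j}))
      else if s v w then 1 else 0)"

lemma sum_complete_rows:
  assumes "finite V" and "\<And>v. v \<notin> V \<Longrightarrow> v < n \<Longrightarrow> (\<Sum>w\<in>V. e v w) = 0" and "v < n"
  shows "(\<Sum>w\<in>V. complete_rows s V \<mu> e v w) = (if v \<in> V then of_real \<mu> else 0)"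
proof (cases "v \<in> V")
  case False
  thus ?thesis using assms by (simp add: complete_rows_def)
next
  case True
  have "(\<Sum>w\<in>V. complete_rows s V \<mu> e v w)
      = complete_rows s V \<mu> e v v + (\<Sum>w\<in>V - {v}. complete_rows s V \<mu> e v w)"
    by (rule sum.remove[OF assms(1) True])
  also have "(\<Sum>w\<in>V - {v}. complete_rows s V \<mu> e v w) = (\<Sum>w\<in>V - {v}. if s v w then 1 else 0)"
    using True by (intro sum.cong) (auto simp: complete_rows_def)
  also have "\<dots> = of_nat (card {j \<in> V - {v}. s v j})"
    using assms(1) by (simp add: sum.If_cases Int_def)
  finally show ?thesis using True by (simp add: complete_rows_def)
qed

lemma pow_mat_diag: "mat_diag n d ^\<^sub>m k = mat_diag n (\<lambda>i. d i ^ k :: 'a::comm_ring_1)"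
proof (induction k)
  case 0
  show ?case by (simp add: mat_diag_def one_mat_def)
next
  case (Suc k)
  thus ?case by (simp add: mult.commute)
qed

lemma mat_exp_diag:
  fixes d :: "nat \<Rightarrow> 'a::{real_normed_field, banach}"
  shows "mat_exp (mat_diag n d) = mat_diag n (\<lambda>i. exp (d i))"
proof (rule eq_matI)
  fix i j assume "i < dim_row (mat_diag n (\<lambda>i. exp (d i)))" "j < dim_col (mat_diag n (\<lambda>i. exp (d i)))"
  hence ij: "i < n" "j < n" by (auto simp: mat_diag_def)
  have "mat_exp (mat_diag n d) $$ (i, j) = (\<Sum>k. (if i = j then d j ^ k else 0) / fact k)"
    using ij by (simp add: mat_exp_def pow_mat_diag) (simp add: mat_diag_def)
  also have "\<dots> = (if i = j then exp (d j) else 0)"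
    by (simp add: exp_def scaleR_conv_of_real divide_inverse mult.commute)
  finally show "mat_exp (mat_diag n d) $$ (i, j) = mat_diag n (\<lambda>i. exp (d i)) $$ (i, j)"
    using ij by (simp add: mat_diag_def)
qed (auto simp: mat_exp_def mat_diag_def)

lemma smult_mat_diag: "c \<cdot>\<^sub>m mat_diag n d = mat_diag n (\<lambda>i. c * d i :: 'a::comm_ring_1)"
  by (rule eq_matI) (auto simp: mat_diag_def)

text \<open>Both counterexamples have a solution of this form: all rates equal the eigenvalue in the
  time-invariant one, and they are the entries of \<open>-\<Lambda>\<close> in the exponentially scaled one.\<close>
definition exponential_trajectory ::
  "nat \<Rightarrow> nat set \<Rightarrow> (nat \<Rightarrow> real) \<Rightarrow> real \<Rightarrow> real \<Rightarrow> 'a::real_normed_field vec" where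
  "exponential_trajectory n V \<kappa> \<tau> t = vec n (\<lambda>i. if i \<in> V then of_real (exp (\<kappa> i * (t - \<tau>))) else 0)"

lemma exponential_trajectory_derivative:
  assumes "i < n"
  shows "((\<lambda>t. vec_index (exponential_trajectory n V \<kappa> \<tau> t) i) has_vector_derivative
     of_real (\<kappa> i) * (vec_index (exponential_trajectory n V \<kappa> \<tau> t) i :: 'a::real_normed_field)) (at t)"
proof (cases "i \<in> V")
  case True
  have "((\<lambda>t. exp (\<kappa> i * (t - \<tau>))) has_real_derivative exp (\<kappa> i * (t - \<tau>)) * \<kappa> i) (at t)"
    by (rule derivative_eq_intros refl | simp)+
  hence "((\<lambda>t. of_real (exp (\<kappa> i * (t - \<tau>))) :: 'a) has_vector_derivative of_real (exp (\<kappa> i * (t - \<tau>)) * \<kappa> i)) (at t)"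
    by (intro has_vector_derivative_of_real) (simp add: has_real_derivative_iff_has_vector_derivative)
  thus ?thesis using assms True by (simp add: exponential_trajectory_def mult.commute)
qed (use assms in \<open>simp add: exponential_trajectory_def\<close>)

lemma exponential_trajectory_abs_continuous:
  assumes "i < n"
  shows "abs_continuous a b (\<lambda>t. vec_index (exponential_trajectory n V \<kappa> \<tau> t) i :: 'a::{real_normed_field, euclidean_space})"
proof (rule abs_continuous_of_continuous_derivative[OF exponential_trajectory_derivative[OF assms]])
  have "continuous_on UNIV (\<lambda>t. of_real (exp (\<kappa> i * (t - \<tau>))) :: 'a)"
    by (intro continuous_intros)
  thus "continuous_on UNIV (\<lambda>t. of_real (\<kappa> i) * (vec_index (exponential_trajectory n V \<kappa> \<tau> t) i :: 'a))"
    using assms by (cases "i \<in> V") (auto simp: exponential_trajectory_def intro!: continuous_intros)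
qed

lemma mult_exponential_trajectory:
  assumes "M \<in> carrier_mat p n" "i < p" "V \<subseteq> {..<n}"
  shows "vec_index (M *\<^sub>v exponential_trajectory n V \<kappa> \<tau> t) i =
    (\<Sum>j\<in>V. M $$ (i, j) * of_real (exp (\<kappa> j * (t - \<tau>))))"
proof -
  have "vec_index (M *\<^sub>v exponential_trajectory n V \<kappa> \<tau> t) i
      = (\<Sum>j<n. M $$ (i, j) * vec_index (exponential_trajectory n V \<kappa> \<tau> t) j)"
    by (rule index_mult_mat_vec_sum[OF assms(1) _ assms(2)]) (simp add: exponential_trajectory_def)
  also have "\<dots> = (\<Sum>j\<in>V. M $$ (i, j) * of_real (exp (\<kappa> j * (t - \<tau>))))"
    by (rule sum.mono_neutral_cong_right) (use assms in \<open>auto simp: exponential_trajectory_def\<close>)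
  finally show ?thesis .
qed

lemma exponential_trajectory_indistinguishable:
  fixes S :: "'a::{real_normed_field, euclidean_space} ct_system"
  assumes S: "is_ct_system n r m S" and B: "\<And>t. coeff_B S t = 0\<^sub>m n r" and V: "V \<subseteq> {..<n}"
    and A: "\<And>i t. i < n \<Longrightarrow> (\<Sum>j\<in>V. coeff_A S t $$ (i, j) * of_real (exp (\<kappa> j * (t - \<tau>)))) =
      (if i \<in> V then of_real (\<kappa> i * exp (\<kappa> i * (t - \<tau>))) else 0)"
    and C: "\<And>k t. k < m \<Longrightarrow> (\<Sum>j\<in>V. coeff_C S t $$ (k, j) * of_real (exp (\<kappa> j * (t - \<tau>)))) = 0"
  shows "indistinguishable n r S \<tau>0 \<tau>1 (exponential_trajectory n V \<kappa> \<tau> \<tau>0) (0\<^sub>v n)"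
proof -
  let ?w = "exponential_trajectory n V \<kappa> \<tau> :: real \<Rightarrow> 'a vec"
  have cA: "coeff_A S t \<in> carrier_mat n n" and cC: "coeff_C S t \<in> carrier_mat m n" for t
    using S by (auto simp: is_ct_system_def)
  show ?thesis
  proof (rule unobserved_trajectory_indistinguishable[OF S B])
    show "?w t \<in> carrier_vec n" for t by (simp add: exponential_trajectory_def)
    show "((\<lambda>s. vec_index (?w s) i) has_vector_derivative vec_index (coeff_A S t *\<^sub>v ?w t) i) (at t)"
      if "i < n" for i t
    proof -
      have "vec_index (coeff_A S t *\<^sub>v ?w t) i = of_real (\<kappa> i) * vec_index (?w t) i"
        unfolding mult_exponential_trajectory[OF cA that V] A[OF that]
        using that by (simp add: exponential_trajectory_def)
      thus ?thesis using exponential_trajectory_derivative[OF that] by simp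
    qed
    show "abs_continuous a b (\<lambda>t. vec_index (?w t) i)" if "i < n" for i a b
      by (rule exponential_trajectory_abs_continuous[OF that])
    show "coeff_C S t *\<^sub>v ?w t = 0\<^sub>v m" for t
    proof (rule eq_vecI)
      fix k assume "k < dim_vec (0\<^sub>v m :: 'a vec)"
      hence k: "k < m" by simp
      show "vec_index (coeff_C S t *\<^sub>v ?w t) k = vec_index (0\<^sub>v m) k"
        unfolding mult_exponential_trajectory[OF cC k V] C[OF k] using k by simp
    qed (use cC[of t] in simp)
  qed
qed

lemma exponential_trajectory_start:
  "exponential_trajectory n V \<kappa> \<tau> \<tau> = vec n (\<lambda>i. if i \<in> V then 1 else 0)"
  by (rule eq_vecI) (auto simp: exponential_trajectory_def)

lemma exponential_trajectory_nonzero: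
  assumes "V \<noteq> {}" "V \<subseteq> {..<n}"
  shows "exponential_trajectory n V \<kappa> \<tau> t \<noteq> (0\<^sub>v n :: 'a::real_normed_field vec)"
proof
  assume eq: "exponential_trajectory n V \<kappa> \<tau> t = (0\<^sub>v n :: 'a vec)"
  obtain i where "i \<in> V" "i < n" using assms by auto
  thus False using arg_cong[OF eq, of "\<lambda>v. vec_index v i"] by (simp add: exponential_trajectory_def)
qed

lemma locally_integrable_mat_continuous:
  assumes "\<And>i j. \<lbrakk>i < p; j < q\<rbrakk> \<Longrightarrow> continuous_on UNIV (\<lambda>t. M t $$ (i, j))"
  shows "locally_integrable_mat p q M"
  unfolding locally_integrable_mat_def
  by (intro allI impI absolutely_integrable_continuous_real continuous_on_subset[OF assms]) auto

text \<open>The indicator vector of \<open>V\<close> is an eigenvector of the state matrix. The eigenvalue exceeds the number of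
  possible stars in a row, which makes the diagonal entries of the rows in \<open>V\<close> nonzero.\<close>
lemma time_invariant_counterexample:
  assumes "\<not> unique_star_condition n m sA sC"
  shows "\<exists>S :: 'a::{real_normed_field, euclidean_space} ct_system. is_ct_system n r m S \<and> time_invariant S \<and>
    of_output_pattern n m (mats_with_support n n (\<lambda>i j. i = j \<or> sA i j)) (mats_with_support m n sC) S \<and>
    \<not> observable n r S"
proof -
  have "\<not> unique_star_condition n m (\<lambda>i j. i = j \<or> sA i j) sC"
    using assms by (simp add: unique_star_condition_diagonal)
  from not_unique_star_imp_balanced_rows[where 'a = 'a, OF this] obtain V and e c :: "nat \<Rightarrow> nat \<Rightarrow> 'a"
    where V: "V \<noteq> {}" "V \<subseteq> {..<n}"
      and eV: "\<forall>v. v < n \<and> v \<notin> V \<longrightarrow> (\<forall>w. e v w \<noteq> 0 \<longleftrightarrow> v = w \<or> sA v w) \<and> (\<Sum>w\<in>V. e v w) = 0"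
      and cV: "\<forall>k. k < m \<longrightarrow> (\<forall>w. c k w \<noteq> 0 \<longleftrightarrow> sC k w) \<and> (\<Sum>w\<in>V. c k w) = 0"
    by (elim exE conjE)
  have e: "e v w \<noteq> 0 \<longleftrightarrow> v = w \<or> sA v w" "(\<Sum>w\<in>V. e v w) = 0" if "v \<notin> V" "v < n" for v w
    using eV that by auto
  have c: "c k w \<noteq> 0 \<longleftrightarrow> sC k w" "(\<Sum>w\<in>V. c k w) = 0" if "k < m" for k w
    using cV that by auto
  have fin: "finite V" using V(2) finite_subset by blast
  define \<mu> where "\<mu> = real (Suc n)"
  define E where "E = complete_rows sA V \<mu> e"
  have sumE: "(\<Sum>w\<in>V. E v w) = (if v \<in> V then of_real \<mu> else 0)" if "v < n" for v
    unfolding E_def by (rule sum_complete_rows[OF fin e(2) that])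
  have suppE: "E v w \<noteq> 0 \<longleftrightarrow> v = w \<or> sA v w" if "v < n" "w < n" for v w
  proof (cases "v \<in> V \<and> v = w")
    case True
    have "card {j \<in> V - {v}. sA v j} \<le> card {..<n}" by (rule card_mono) (use V in auto)
    hence "\<mu> - real (card {j \<in> V - {v}. sA v j}) \<noteq> 0" by (simp add: \<mu>_def)
    thus ?thesis using True by (auto simp: E_def complete_rows_def simp del: of_real_diff)
  next
    case False
    thus ?thesis using e(1)[of v w] that by (auto simp: E_def complete_rows_def)
  qed
  define A where "A = mat n n (\<lambda>(i, j). E i j)"
  define C where "C = mat m n (\<lambda>(k, j). c k j)"
  define S :: "'a ct_system" where "S = \<lparr>coeff_A = \<lambda>_. A, coeff_B = \<lambda>_. 0\<^sub>m n r, coeff_C = \<lambda>_. C, coeff_D = \<lambda>_. 0\<^sub>m m r\<rparr>"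
  have sys: "is_ct_system n r m S"
    by (auto simp: is_ct_system_def S_def A_def C_def intro!: locally_integrable_mat_continuous)
  have "time_invariant S" by (auto simp: time_invariant_def S_def)
  moreover have "of_output_pattern n m (mats_with_support n n (\<lambda>i j. i = j \<or> sA i j)) (mats_with_support m n sC) S"
    unfolding of_output_pattern_def
    by (auto simp: S_def A_def C_def mats_with_support_def suppE c(1)
        intro!: locally_integrable_mat_continuous AE_I2)
  moreover have "\<not> observable n r S"
  proof
    assume "observable n r S"
    moreover have "indistinguishable n r S \<tau>0 \<tau>1 (vec n (\<lambda>i. if i \<in> V then 1 else 0)) (0\<^sub>v n)" for \<tau>0 \<tau>1
      unfolding exponential_trajectory_start[symmetric, where \<kappa> = "\<lambda>_. \<mu>" and \<tau> = \<tau>0]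
    proof (rule exponential_trajectory_indistinguishable[OF sys _ V(2), where \<kappa> = "\<lambda>_. \<mu>"])
      fix i t assume i: "i < n"
      have "(\<Sum>j\<in>V. coeff_A S t $$ (i, j) * of_real (exp (\<mu> * (t - \<tau>0))))
          = (\<Sum>j\<in>V. E i j) * of_real (exp (\<mu> * (t - \<tau>0)))"
        unfolding sum_distrib_right using V i by (intro sum.cong) (auto simp: S_def A_def)
      thus "(\<Sum>j\<in>V. coeff_A S t $$ (i, j) * of_real (exp (\<mu> * (t - \<tau>0)))) =
          (if i \<in> V then of_real (\<mu> * exp (\<mu> * (t - \<tau>0))) else 0)"
        by (simp add: sumE[OF i])
    next
      fix k t assume k: "k < m"
      have "(\<Sum>j\<in>V. coeff_C S t $$ (k, j) * of_real (exp (\<mu> * (t - \<tau>0))))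
          = (\<Sum>j\<in>V. c k j) * of_real (exp (\<mu> * (t - \<tau>0)))"
        unfolding sum_distrib_right using V k by (intro sum.cong) (auto simp: S_def C_def)
      thus "(\<Sum>j\<in>V. coeff_C S t $$ (k, j) * of_real (exp (\<mu> * (t - \<tau>0)))) = 0"
        by (simp add: c(2)[OF k])
    qed (simp add: S_def)
    ultimately have "vec n (\<lambda>i. if i \<in> V then 1 else 0 :: 'a) = 0\<^sub>v n"
      unfolding observable_def by blast
    thus False
      using exponential_trajectory_nonzero[OF V] exponential_trajectory_start[where 'a = 'a] by metis
  qed
  ultimately show ?thesis using sys by blast
qed

text \<open>The unscaled system has the indicator vector of \<open>V\<close> as a constant unobserved solution, but the
  diagonal entries of its rows in \<open>V\<close> are dictated by the row sums. The scaling subtracts \<open>\<Lambda>\<close>, so the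
  diagonal entries can be reset to \<open>1\<close> or \<open>0\<close> as the pattern demands; this determines \<open>l\<close>.\<close>
lemma exponentially_scaled_counterexample:
  assumes "\<not> unique_star_condition n m sA sC"
  shows "\<exists>S :: 'a::{real_normed_field, euclidean_space} ct_system. is_ct_system n r m S \<and> exponentially_scaled n r m S \<and>
    of_output_pattern n m (mats_with_support n n sA) (mats_with_support m n sC) S \<and>
    \<not> observable_on n r S t0 t1"
proof -
  from not_unique_star_imp_balanced_rows[where 'a = 'a, OF assms] obtain V and e c :: "nat \<Rightarrow> nat \<Rightarrow> 'a"
    where V: "V \<noteq> {}" "V \<subseteq> {..<n}"
      and eV: "\<forall>v. v < n \<and> v \<notin> V \<longrightarrow> (\<forall>w. e v w \<noteq> 0 \<longleftrightarrow> sA v w) \<and> (\<Sum>w\<in>V. e v w) = 0"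
      and cV: "\<forall>k. k < m \<longrightarrow> (\<forall>w. c k w \<noteq> 0 \<longleftrightarrow> sC k w) \<and> (\<Sum>w\<in>V. c k w) = 0"
    by (elim exE conjE)
  have e: "e v w \<noteq> 0 \<longleftrightarrow> sA v w" "(\<Sum>w\<in>V. e v w) = 0" if "v \<notin> V" "v < n" for v w
    using eV that by auto
  have c: "c k w \<noteq> 0 \<longleftrightarrow> sC k w" "(\<Sum>w\<in>V. c k w) = 0" if "k < m" for k w
    using cV that by auto
  have fin: "finite V" using V(2) finite_subset by blast
  define E where "E = complete_rows sA V 0 e"
  have sumE: "(\<Sum>w\<in>V. E v w) = 0" if "v < n" for v
    using sum_complete_rows[OF fin e(2) that, where s = sA and \<mu> = 0] by (simp add: E_def)
  define l where "l v = (if v \<in> V then - real (card {j \<in> V - {v}. sA v j}) - of_bool (sA v v) else 0)" for v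
  define \<Lambda> :: "'a mat" where "\<Lambda> = mat_diag n (\<lambda>i. of_real (l i))"
  define A0 where "A0 = mat n n (\<lambda>(i, j). E i j)"
  define C0 where "C0 = mat m n (\<lambda>(k, j). c k j)"
  define S :: "'a ct_system" where "S = \<lparr>
      coeff_A = \<lambda>t. mat_exp (of_real (- t) \<cdot>\<^sub>m \<Lambda>) * A0 * mat_exp (of_real t \<cdot>\<^sub>m \<Lambda>) - \<Lambda>,
      coeff_B = \<lambda>t. mat_exp (of_real (- t) \<cdot>\<^sub>m \<Lambda>) * 0\<^sub>m n r,
      coeff_C = \<lambda>t. C0 * mat_exp (of_real t \<cdot>\<^sub>m \<Lambda>),
      coeff_D = \<lambda>_. 0\<^sub>m m r\<rparr>"
  have exp\<Lambda>: "mat_exp (of_real t \<cdot>\<^sub>m \<Lambda>) = mat_diag n (\<lambda>i. of_real (exp (t * l i)))" for t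
    unfolding \<Lambda>_def smult_mat_diag mat_exp_diag by (simp flip: of_real_mult exp_of_real)
  have A_eq: "coeff_A S t = mat n n (\<lambda>(i, j). of_real (exp (- t * l i)) * E i j * of_real (exp (t * l j))
      - (if i = j then of_real (l i) else 0))" for t
    unfolding S_def ct_system.simps exp\<Lambda>
    by (simp add: mat_diag_mult_left[of _ n n] mat_diag_mult_right[of _ n n] A0_def)
       (auto simp: \<Lambda>_def mat_diag_def intro!: eq_matI)
  have B_eq: "coeff_B S t = 0\<^sub>m n r" for t
    unfolding S_def ct_system.simps exp\<Lambda> by (simp add: mat_diag_def)
  have C_eq: "coeff_C S t = mat m n (\<lambda>(k, j). c k j * of_real (exp (t * l j)))" for t
    unfolding S_def ct_system.simps exp\<Lambda>
    by (simp add: mat_diag_mult_right[of _ m n] C0_def) (auto intro!: eq_matI)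
  have suppA: "of_real (exp (- t * l i)) * E i j * of_real (exp (t * l j)) - (if i = j then of_real (l i) else 0) \<noteq> 0
      \<longleftrightarrow> sA i j" if "i < n" "j < n" for i j t
  proof (cases "i = j")
    case True
    have "of_real (exp (- t * l i)) * E i i * of_real (exp (t * l i))
        = of_real (exp (- t * l i)) * of_real (exp (t * l i)) * E i i" by (simp only: mult_ac)
    also have "of_real (exp (- t * l i)) * of_real (exp (t * l i)) = (1::'a)"
      by (simp flip: of_real_mult exp_add)
    finally have conj: "of_real (exp (- t * l i)) * E i i * of_real (exp (t * l i)) = E i i" by simp
    have "E i i - of_real (l i) \<noteq> 0 \<longleftrightarrow> sA i i"
      using e(1)[of i i] that by (auto simp: E_def complete_rows_def l_def)
    thus ?thesis unfolding True[symmetric] by (simp only: conj refl if_True)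
  next
    case False
    have "E i j \<noteq> 0 \<longleftrightarrow> sA i j"
      using e(1)[of i j] that False by (auto simp: E_def complete_rows_def)
    thus ?thesis using False by simp
  qed
  have locA: "locally_integrable_mat n n (coeff_A S)"
    by (rule locally_integrable_mat_continuous) (auto simp: A_eq intro!: continuous_intros)
  have locC: "locally_integrable_mat m n (coeff_C S)"
    by (rule locally_integrable_mat_continuous) (auto simp: C_eq intro!: continuous_intros)
  have locB: "locally_integrable_mat n r (coeff_B S)"
    by (rule locally_integrable_mat_continuous) (auto simp: B_eq intro!: continuous_intros)
  have sys: "is_ct_system n r m S"
    using locA locB by (auto simp: is_ct_system_def A_eq B_eq C_eq) (simp add: S_def)
  moreover have "exponentially_scaled n r m S"
    unfolding exponentially_scaled_def
  proof (intro bexI conjI allI)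
    show "diagonal_mat \<Lambda>" by (auto simp: diagonal_mat_def \<Lambda>_def mat_diag_def)
  qed (auto simp: S_def \<Lambda>_def A0_def C0_def)
  moreover have "of_output_pattern n m (mats_with_support n n sA) (mats_with_support m n sC) S"
    unfolding of_output_pattern_def using locA locC suppA c(1)
    by (auto simp: A_eq C_eq mats_with_support_def intro!: AE_I2)
  moreover have "\<not> observable_on n r S t0 t1"
  proof
    assume "observable_on n r S t0 t1"
    moreover have "indistinguishable n r S t0 t1 (exponential_trajectory n V (\<lambda>i. - l i) 0 t0) (0\<^sub>v n)"
    proof (rule exponential_trajectory_indistinguishable[OF sys B_eq V(2)])
      fix i t assume i: "i < n"
      have cancel: "of_real (exp (t * l j)) * of_real (exp (- l j * (t - 0))) = (1::'a)" for j
        by (simp flip: of_real_mult exp_add)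
      have "(\<Sum>j\<in>V. coeff_A S t $$ (i, j) * of_real (exp (- l j * (t - 0))))
          = (\<Sum>j\<in>V. of_real (exp (- t * l i)) * E i j - (if i = j then of_real (l i * exp (- l i * (t - 0))) else 0))"
      proof (rule sum.cong[OF refl])
        fix j assume "j \<in> V"
        hence "coeff_A S t $$ (i, j) * of_real (exp (- l j * (t - 0)))
            = of_real (exp (- t * l i)) * E i j * (of_real (exp (t * l j)) * of_real (exp (- l j * (t - 0))))
              - (if i = j then of_real (l i) else 0) * of_real (exp (- l j * (t - 0)))"
          using i V(2) by (auto simp: A_eq left_diff_distrib mult.assoc)
        thus "coeff_A S t $$ (i, j) * of_real (exp (- l j * (t - 0)))
            = of_real (exp (- t * l i)) * E i j - (if i = j then of_real (l i * exp (- l i * (t - 0))) else 0)"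
          unfolding cancel by simp
      qed
      also have "\<dots> = of_real (exp (- t * l i)) * (\<Sum>j\<in>V. E i j)
          - (if i \<in> V then of_real (l i * exp (- l i * (t - 0))) else 0)"
        using fin by (simp add: sum_subtractf sum_distrib_left)
      finally show "(\<Sum>j\<in>V. coeff_A S t $$ (i, j) * of_real (exp (- l j * (t - 0)))) =
          (if i \<in> V then of_real (- l i * exp (- l i * (t - 0))) else 0)"
        by (simp add: sumE[OF i])
    next
      fix k t assume k: "k < m"
      have cancel: "of_real (exp (t * l j)) * of_real (exp (- l j * (t - 0))) = (1::'a)" for j
        by (simp flip: of_real_mult exp_add)
      have "(\<Sum>j\<in>V. coeff_C S t $$ (k, j) * of_real (exp (- l j * (t - 0)))) = (\<Sum>j\<in>V. c k j)"
      proof (rule sum.cong[OF refl])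
        fix j assume "j \<in> V"
        hence "coeff_C S t $$ (k, j) * of_real (exp (- l j * (t - 0)))
            = c k j * (of_real (exp (t * l j)) * of_real (exp (- l j * (t - 0))))"
          using k V(2) by (auto simp: C_eq mult.assoc)
        thus "coeff_C S t $$ (k, j) * of_real (exp (- l j * (t - 0))) = c k j"
          unfolding cancel by simp
      qed
      thus "(\<Sum>j\<in>V. coeff_C S t $$ (k, j) * of_real (exp (- l j * (t - 0)))) = 0"
        by (simp add: c(2)[OF k])
    qed
    ultimately show False
      using exponential_trajectory_nonzero[OF V] unfolding observable_on_def by blast
  qed
  ultimately show ?thesis by blast
qed

section \<open>The four statements are equivalent\<close>

text \<open>The argument is uniform in the scalar field. The time-invariant statement concerns a
  pattern with stars on the diagonal, to which the graph condition is indifferent.\<close>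
lemma structural_observability_equivalence:
  fixes \<A> \<C> :: "'a::{real_normed_field, euclidean_space, conjugatable_field} mat set"
  assumes \<A>: "\<A> \<in> patterns n n" and \<C>: "\<C> \<in> patterns m n" and t01: "t0 < t1"
  shows "(all_systems_observable n r m t0 t1 \<A> \<C> \<longleftrightarrow>
           all_exp_scaled_systems_observable n r m t0 t1 \<A> \<C>) \<and>
        (all_exp_scaled_systems_observable n r m t0 t1 \<A> \<C> \<longleftrightarrow>
           all_time_invariant_systems_observable n r m (pattern_add (pattern_of (1\<^sub>m n)) \<A>) \<C>) \<and>
        (all_time_invariant_systems_observable n r m (pattern_add (pattern_of (1\<^sub>m n)) \<A>) \<C> \<longleftrightarrow>
           unique_successor_condition n (pattern_graph n m \<A> \<C>))"
proof -
  let ?sA = "pattern_star \<A>" and ?sC = "pattern_star \<C>"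
  let ?A1 = "pattern_add (pattern_of (1\<^sub>m n)) \<A>"
  have supp: "mats_with_support n n ?sA = \<A>" "mats_with_support m n ?sC = \<C>"
    "mats_with_support n n (\<lambda>i j. i = j \<or> ?sA i j) = ?A1"
    using patterns_eq_mats_with_support[OF \<A>] patterns_eq_mats_with_support[OF \<C>]
      pattern_add_one[OF \<A>] by auto
  have iv: "unique_successor_condition n (pattern_graph n m \<A> \<C>) \<longleftrightarrow> unique_star_condition n m ?sA ?sC"
    by (rule unique_successor_iff_unique_star[OF \<A> \<C>])
  have "all_systems_observable n r m t0 t1 \<A> \<C>" if "unique_star_condition n m ?sA ?sC"
    unfolding all_systems_observable_def
  proof (intro allI impI, elim conjE)
    fix S assume "is_ct_system n r m S" "of_output_pattern n m \<A> \<C> S"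
    thus "observable_on n r S t0 t1"
      by (intro unique_star_imp_observable_on[OF that t01]) (simp_all only: supp)
  qed
  moreover have "all_exp_scaled_systems_observable n r m t0 t1 \<A> \<C>"
    if "all_systems_observable n r m t0 t1 \<A> \<C>"
    using that unfolding all_systems_observable_def all_exp_scaled_systems_observable_def by blast
  moreover have "unique_star_condition n m ?sA ?sC"
    if "all_exp_scaled_systems_observable n r m t0 t1 \<A> \<C>"
  proof (rule ccontr)
    assume "\<not> unique_star_condition n m ?sA ?sC"
    from exponentially_scaled_counterexample[where 'a = 'a, OF this, of r t0 t1]
    show False using that unfolding all_exp_scaled_systems_observable_def supp by blast
  qed
  moreover have "all_time_invariant_systems_observable n r m ?A1 \<C>" if "unique_star_condition n m ?sA ?sC"
    unfolding all_time_invariant_systems_observable_def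
  proof (intro allI impI, elim conjE)
    fix S assume S: "is_ct_system n r m S" "of_output_pattern n m ?A1 \<C> S" and "time_invariant S"
    have cond: "unique_star_condition n m (\<lambda>i j. i = j \<or> ?sA i j) ?sC"
      using that by (simp only: unique_star_condition_diagonal)
    have "observable_on n r S 0 1"
      by (rule unique_star_imp_observable_on[OF cond _ S(1)]) (simp_all only: supp S(2) zero_less_one)
    thus "observable n r S" unfolding observable_def observable_on_def by auto
  qed
  moreover have "unique_star_condition n m ?sA ?sC" if "all_time_invariant_systems_observable n r m ?A1 \<C>"
  proof (rule ccontr)
    assume "\<not> unique_star_condition n m ?sA ?sC"
    from time_invariant_counterexample[where 'a = 'a, OF this, of r]
    show False using that unfolding all_time_invariant_systems_observable_def supp by blast
  qed
  ultimately show ?thesis unfolding iv by argo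
qed

theorem corollary2:
  fixes n r m :: nat and t0 t1 :: real
  assumes "n \<ge> 1" and "t0 < t1"
  shows
    "(\<forall>\<A> \<in> (patterns n n :: real mat set set). \<forall>\<C> \<in> patterns m n.
        (all_systems_observable n r m t0 t1 \<A> \<C> \<longleftrightarrow>
           all_exp_scaled_systems_observable n r m t0 t1 \<A> \<C>) \<and>
        (all_exp_scaled_systems_observable n r m t0 t1 \<A> \<C> \<longleftrightarrow>
           all_time_invariant_systems_observable n r m (pattern_add (pattern_of (1\<^sub>m n)) \<A>) \<C>) \<and>
        (all_time_invariant_systems_observable n r m (pattern_add (pattern_of (1\<^sub>m n)) \<A>) \<C> \<longleftrightarrow>
           unique_successor_condition n (pattern_graph n m \<A> \<C>))) \<and>
     (\<forall>\<A> \<in> (patterns n n :: complex mat set set). \<forall>\<C> \<in> patterns m n.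
        (all_systems_observable n r m t0 t1 \<A> \<C> \<longleftrightarrow>
           all_exp_scaled_systems_observable n r m t0 t1 \<A> \<C>) \<and>
        (all_exp_scaled_systems_observable n r m t0 t1 \<A> \<C> \<longleftrightarrow>
           all_time_invariant_systems_observable n r m (pattern_add (pattern_of (1\<^sub>m n)) \<A>) \<C>) \<and>
        (all_time_invariant_systems_observable n r m (pattern_add (pattern_of (1\<^sub>m n)) \<A>) \<C> \<longleftrightarrow>
           unique_successor_condition n (pattern_graph n m \<A> \<C>)))"
  by (rule conjI; intro ballI; rule structural_observability_equivalence[OF _ _ assms(2)])

end
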